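(* Let $n\geq 4$ be an integer. Then there exist a domain $\Omega\subseteq\mathbb{R}^{n}$, a function $u:\Omega\to\mathbb{R}$ and a constant $\delta>0$ such that: (i) $u\in W^{2,q}_{\mathrm{loc}}(\Omega)$ for every real $q$ with $1\leq q<\frac{n(n-1)}{2}$; (ii) $u\notin W^{2,n(n-1)/2}_{\mathrm{loc}}(\Omega)$; (iii) $\det D^2u(x)\geq\delta$ for almost every $x\in\Omega$ (with respect to Lebesgue measure); (iv) the gradient mapping $Du:\Omega\to\mathbb{R}^n$ is not an open mapping, and $Du$ is not a discrete mapping.
   Context: A domain is a nonempty connected open subset of $\mathbb{R}^n$. $W^{2,q}_{\mathrm{loc}}(\Omega)$ is the usual local Sobolev space of functions whose weak derivatives up to order $2$ lie in $L^q_{\mathrm{loc}}(\Omega)$. $Du$ denotes the gradient of $u$ and $D^2u$ its (weak) Hessian matrix. Since $n\ge 4$ gives $n(n-1)/2>n$, condition (i) implies that $Du$ has a continuous representative, and $Du$ in (iv) means this continuous map $\Omega\to\mathbb{R}^n$. A mapping $f:\Omega\to\mathbb{R}^n$ is called discrete if for every $y\in\mathbb{R}^n$ the fiber $f^{-1}(y)$ is a discrete subset of $\Omega$. A mapping $f:\Omega\to\mathbb{R}^n$ is called open if for every open set $U\subset\Omega$ the image $f(U)$ is open in $\mathbb{R}^n$. *)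

theory Defs
  imports "HOL-Analysis.Analysis"
begin

definition is_domain :: "(real^'n) set \<Rightarrow> bool" where
  "is_domain \<Omega> \<longleftrightarrow> open \<Omega> \<and> connected \<Omega> \<and> \<Omega> \<noteq> {}"

definition partial :: "'n \<Rightarrow> (real^'n \<Rightarrow> real) \<Rightarrow> real^'n \<Rightarrow> real" where
  "partial i f x = frechet_derivative f (at x) (axis i 1)"

text \<open>A list of coordinate indices plays the role of a multi-index; its length is the order.\<close>

primrec partials :: "'n list \<Rightarrow> (real^'n \<Rightarrow> real) \<Rightarrow> real^'n \<Rightarrow> real" where
  "partials [] f = f"
| "partials (i # is) f = partial i (partials is f)"

text \<open>Differentiability of every iterated partial derivative gives continuity of all of them,
  so this is exactly the class of infinitely differentiable functions on the whole space.\<close>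

definition smooth :: "(real^'n \<Rightarrow> real) \<Rightarrow> bool" where
  "smooth f \<longleftrightarrow> (\<forall>is x. partials is f differentiable (at x))"

definition test_function :: "(real^'n) set \<Rightarrow> (real^'n \<Rightarrow> real) \<Rightarrow> bool" where
  "test_function \<Omega> \<phi> \<longleftrightarrow>
     smooth \<phi> \<and> compact (closure {x. \<phi> x \<noteq> 0}) \<and> closure {x. \<phi> x \<noteq> 0} \<subseteq> \<Omega>"

text \<open>Functions on an open set are represented by functions on the whole type.  All notions below
  depend only on the values on the open set.\<close>

definition Lq_loc :: "real \<Rightarrow> (real^'n) set \<Rightarrow> (real^'n \<Rightarrow> real) \<Rightarrow> bool" where
  "Lq_loc q \<Omega> f \<longleftrightarrow>
     (\<forall>K. compact K \<and> K \<subseteq> \<Omega> \<longrightarrow>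
        set_borel_measurable lebesgue K f \<and>
        set_integrable lebesgue K (\<lambda>x. \<bar>f x\<bar> powr q))"

definition weak_deriv ::
  "(real^'n) set \<Rightarrow> 'n list \<Rightarrow> (real^'n \<Rightarrow> real) \<Rightarrow> (real^'n \<Rightarrow> real) \<Rightarrow> bool" where
  "weak_deriv \<Omega> is u v \<longleftrightarrow>
     Lq_loc 1 \<Omega> u \<and> Lq_loc 1 \<Omega> v \<and>
     (\<forall>\<phi>. test_function \<Omega> \<phi> \<longrightarrow>
        (LINT x:\<Omega>|lebesgue. u x * partials is \<phi> x) =
        (-1) ^ length is * (LINT x:\<Omega>|lebesgue. v x * \<phi> x))"

definition W_loc :: "nat \<Rightarrow> real \<Rightarrow> (real^'n) set \<Rightarrow> (real^'n \<Rightarrow> real) set" where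
  "W_loc k q \<Omega> =
     {u. Lq_loc q \<Omega> u \<and>
         (\<forall>is. length is \<le> k \<longrightarrow> (\<exists>v. weak_deriv \<Omega> is u v \<and> Lq_loc q \<Omega> v))}"

definition weak_gradient ::
  "(real^'n) set \<Rightarrow> (real^'n \<Rightarrow> real) \<Rightarrow> (real^'n \<Rightarrow> real^'n) \<Rightarrow> bool" where
  "weak_gradient \<Omega> u G \<longleftrightarrow> (\<forall>i. weak_deriv \<Omega> [i] u (\<lambda>x. G x $ i))"

definition weak_hessian ::
  "(real^'n) set \<Rightarrow> (real^'n \<Rightarrow> real) \<Rightarrow> (real^'n \<Rightarrow> real^'n^'n) \<Rightarrow> bool" where
  "weak_hessian \<Omega> u H \<longleftrightarrow> (\<forall>i j. weak_deriv \<Omega> [i, j] u (\<lambda>x. H x $ i $ j))"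

definition discrete_map_on ::
  "(real^'n) set \<Rightarrow> (real^'n \<Rightarrow> real^'n) \<Rightarrow> bool" where
  "discrete_map_on \<Omega> f \<longleftrightarrow> (\<forall>y. discrete {x \<in> \<Omega>. f x = y})"

end

theory Submission
  imports Defs
begin

text \<open>
  The example is Pogorelov's: singling out a coordinate \<open>k\<close> and writing \<open>r\<close> for the distance to the
  \<open>k\<close>-axis and \<open>t = x\<^sub>k\<close>, take \<open>u = r\<^bsup>2 - 2/n\<^esup> (1 + t\<^sup>2)\<close> on \<open>\<bar>t\<bar> < 1/4\<close>.  The exponent is the one for which the
  powers of \<open>r\<close> cancel in \<open>det D\<^sup>2u\<close>, leaving a positive function of \<open>t\<close>.  Since \<open>|D\<^sup>2u|\<close> is comparable to
  \<open>r\<^bsup>-2/n\<^esup>\<close> and the cross-section has dimension \<open>n - 1\<close>, it lies in \<open>L\<^sup>q\<close> locally exactly when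
  \<open>2q/n < n - 1\<close>.  The gradient vanishes on the whole axis, and it vanishes wherever its
  components other than the \<open>k\<close>-th do, so its image contains \<open>0\<close> but no other multiple of \<open>e\<^sub>k\<close>.

  Weak derivatives are obtained by replacing \<open>r\<^sup>2\<close> with \<open>r\<^sup>2 + \<epsilon>\<close> and letting \<open>\<epsilon> \<rightarrow> 0\<close> under the dominating
  function \<open>r\<^bsup>-2/n\<^esup>\<close>.  That no function \<open>v\<close> in the critical \<open>L\<^sup>q\<close> is a weak second derivative is seen by testing
  against bumps on disjoint cells at distance about \<open>4\<^bsup>-m\<^esup>\<close> from the axis: each cell carries a fixed
  amount of \<open>\<integral>|v|\<^sup>q\<close>, uniformly in \<open>m\<close>.
\<close>

subsection \<open>Determinants of rank-one perturbations\<close>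

text \<open>Cramer's rule for the identity matrix, whose rows combine to \<open>v\<close> with the
  components of \<open>v\<close> as coefficients.\<close>

lemma det_identity_row_replaced:
  fixes v :: "'a::field^'n"
  shows "det (\<chi> j. if j = i then v else axis j 1) = v $ i"
proof -
  have "(\<Sum>j\<in>UNIV. v $ j *s row j (mat 1 :: 'a^'n^'n)) = v"
    by (simp add: vec_eq_iff row_def mat_def if_distrib[of "(*) _"] cong: if_cong)
  moreover have "row j (mat 1 :: 'a^'n^'n) = axis j 1" for j
    by (simp add: vec_eq_iff row_def mat_def axis_def)
  ultimately show ?thesis
    using cramer_lemma_transpose[where x = v and k = i and A = "mat 1 :: 'a^'n^'n"]
    by (simp cong del: if_weak_cong)
qed

text \<open>The rank-one part is added one row at a time: \<open>R T\<close> has it in the rows of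
  \<open>T\<close> only. By linearity in row \<open>l\<close>, the determinant grows by
  \<open>u $ l\<close> times the determinant with that row replaced by \<open>v\<close>.\<close>

lemma det_identity_plus_rank_one:
  fixes u v :: "'a::field^'n"
  shows "det (\<chi> i j. (if i = j then 1 else 0) + u $ i * v $ j) = 1 + (\<Sum>i\<in>UNIV. u $ i * v $ i)"
proof -
  define R where "R T = (\<lambda>j::'n. if j \<in> T then axis j 1 + u $ j *s v else axis j 1 :: 'a^'n)" for T
  \<comment> \<open>Next to a row equal to \<open>v\<close>, the multiples of \<open>v\<close> in
    the other rows are removed by row operations, which leaves the identity matrix with one row
    replaced.\<close>
  have replaced: "det (\<chi> j. if j = i then v else R T j) = v $ i" if "finite T" "i \<notin> T" for i T
    using that
  proof (induction T rule: finite_induct)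
    case empty
    show ?case using det_identity_row_replaced[of i v] by (simp add: R_def cong del: if_weak_cong)
  next
    case (insert l T)
    let ?A = "(\<chi> j. if j = i then v else R T j) :: 'a^'n^'n"
    from insert have "l \<noteq> i" by auto
    have "(\<chi> j. if j = i then v else R (insert l T) j) =
        (\<chi> j. if j = l then row l ?A + u $ l *s row i ?A else row j ?A)"
      using insert \<open>l \<noteq> i\<close> by (auto simp: vec_eq_iff row_def R_def)
    then show ?case
      using det_row_operation[OF \<open>l \<noteq> i\<close>, of ?A "u $ l"] insert by simp
  qed
  have "det (\<chi> j. R T j) = 1 + (\<Sum>i\<in>T. u $ i * v $ i)" if "finite T" for T
    using that
  proof (induction T rule: finite_induct)
    case empty
    have "(\<chi> j. (axis j 1 :: 'a^'n)) = mat 1"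
      by (simp add: vec_eq_iff mat_def axis_def)
    then show ?case by (simp add: R_def)
  next
    case (insert l T)
    have "(\<chi> j. R (insert l T) j) =
        (\<chi> j. if j = l then axis l 1 + u $ l *s v else R T j)"
      using insert by (auto simp: vec_eq_iff R_def)
    also have "det \<dots> = det (\<chi> j. if j = l then axis l 1 else R T j) + u $ l * v $ l"
      by (simp add: det_row_add[of l "\<lambda>_. axis l 1"] det_row_mul[of l _ "\<lambda>_. v"]
          replaced[OF insert(1,2)])
    also have "(\<chi> j. if j = l then axis l 1 else R T j) = (\<chi> j. R T j)"
      using insert by (auto simp: vec_eq_iff R_def)
    finally show ?case
      using insert by (simp add: algebra_simps)
  qed
  from this[of UNIV] show ?thesis
    by (simp add: R_def axis_def vec_eq_iff vector_add_component cong: if_cong)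
       (auto simp: plus_vec_def vec_lambda_unique eq_commute cong: if_cong)
qed

text \<open>With \<open>L = I + (c/d) y e\<^sub>k\<^sup>T\<close>, the matrix is \<open>L D (I + s y y\<^sup>T) L\<^sup>T\<close>
  for a diagonal matrix \<open>D\<close>.\<close>

lemma det_bordered_rank_one:
  fixes y :: "'a::field^'n" and k :: 'n
  assumes yk: "y $ k = 0" and "a \<noteq> 0" "d \<noteq> 0" and card2: "CARD('n) \<ge> 2"
  shows "det (\<chi> i j. if i = k \<and> j = k then d else if j = k then c * y $ i else if i = k then c * y $ j
       else (if i = j then a else 0) + b * y $ i * y $ j)
     = a ^ (CARD('n) - 2) * (d * (a + b * (\<Sum>i\<in>UNIV. y $ i * y $ i)) - c\<^sup>2 * (\<Sum>i\<in>UNIV. y $ i * y $ i))"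
proof -
  define N where "N = (\<Sum>i\<in>UNIV. y $ i * y $ i)"
  \<comment> \<open>\<open>L\<close> clears the border with pivot \<open>d\<close>. The Schur
    complement that remains is \<open>a I + (b - c^2/d) y y^T\<close>, and dividing by
    \<open>a\<close> gives \<open>s\<close>.\<close>
  define s where "s = (b - c\<^sup>2 / d) / a"
  define L :: "'a^'n^'n" where "L = (\<chi> i j. (if i = j then 1 else 0) + y $ i * (axis k (c / d)) $ j)"
  define D :: "'a^'n^'n" where "D = (\<chi> i j. if i = j then if i = k then d else a else 0)"
  define E :: "'a^'n^'n" where "E = (\<chi> i j. (if i = j then 1 else 0) + y $ i * (s *s y) $ j)"
  let ?H = "(\<chi> i j. if i = k \<and> j = k then d else if j = k then c * y $ i
      else if i = k then c * y $ j else (if i = j then a else 0) + b * y $ i * y $ j) :: 'a^'n^'n"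
  have delta: "(\<Sum>j\<in>UNIV. (if i = j then p j else q j) * \<xi> $ j)
      = (p i - q i) * \<xi> $ i + (\<Sum>j\<in>UNIV. q j * \<xi> $ j)" for i :: 'n and p q and \<xi> :: "'a^'n"
    by (simp add: sum.remove[of _ i] algebra_simps)
  \<comment> \<open>Matrices are compared through their action on an arbitrary vector, where each
    factor becomes an explicit formula in the pairing \<open>P\<close> with
    \<open>y\<close>.\<close>
  define P where "P \<xi> = (\<Sum>j\<in>UNIV. y $ j * \<xi> $ j)" for \<xi>
  have L: "(L *v \<xi>) $ i = \<xi> $ i + c / d * \<xi> $ k * y $ i" for \<xi> i
    by (simp add: L_def matrix_vector_mult_def axis_def algebra_simps sum.distrib
        if_distrib[of "(*) _"] cong: if_cong)
  have LT: "(transpose L *v \<xi>) $ i = \<xi> $ i + (if i = k then c / d * P \<xi> else 0)" for \<xi> i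
    by (simp add: L_def transpose_def matrix_vector_mult_def axis_def algebra_simps sum.distrib P_def
        sum_distrib_left if_distrib[of "(*) _"] sum_divide_distrib cong: if_cong)
  have E: "(E *v \<xi>) $ i = \<xi> $ i + s * P \<xi> * y $ i" for \<xi> i
    by (simp add: E_def matrix_vector_mult_def algebra_simps sum.distrib P_def
        sum_distrib_left if_distrib[of "(*) _"] cong: if_cong)
  have D: "(D *v \<xi>) $ i = (if i = k then d else a) * \<xi> $ i" for \<xi> i
    by (simp add: D_def matrix_vector_mult_def if_distrib[of "\<lambda>x. x * _"] cong: if_cong)
  have H: "(?H *v \<xi>) $ i = (if i = k then d * \<xi> $ k + c * P \<xi>
      else a * \<xi> $ i + c * \<xi> $ k * y $ i + b * y $ i * P \<xi>)" for \<xi> i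
  proof (cases "i = k")
    case True
    have "(?H *v \<xi>) $ i = (\<Sum>j\<in>UNIV. (if k = j then d * \<xi> $ j else 0) + c * (y $ j * \<xi> $ j))"
      using True yk by (auto simp: matrix_vector_mult_def intro!: sum.cong)
    then show ?thesis using True by (simp add: sum.distrib P_def sum_distrib_left)
  next
    case False
    have "(?H *v \<xi>) $ i = (\<Sum>j\<in>UNIV. (if i = j then a * \<xi> $ j else 0)
        + (if k = j then c * \<xi> $ j * y $ i else 0) + b * y $ i * (y $ j * \<xi> $ j))"
      using False yk by (auto simp: matrix_vector_mult_def algebra_simps intro!: sum.cong)
    then show ?thesis using False by (simp add: sum.distrib P_def sum_distrib_left)
  qed
  have PLT: "P (transpose L *v \<xi>) = P \<xi>" for \<xi>
    unfolding P_def LT using yk by (auto intro!: sum.cong)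
  have "?H *v \<xi> = (L ** D ** E ** transpose L) *v \<xi>" for \<xi>
    using yk \<open>a \<noteq> 0\<close> \<open>d \<noteq> 0\<close>
    by (simp add: vec_eq_iff matrix_vector_mul_assoc[symmetric] H L D E LT PLT del: transpose_matrix_vector)
       (simp add: s_def field_simps power2_eq_square)
  then have fact: "?H = L ** D ** E ** transpose L"
    by (simp add: matrix_eq)
  have "det L = 1"
    unfolding L_def det_identity_plus_rank_one
    using yk by (simp add: axis_def if_distrib[of "(*) _"] cong: if_cong)
  moreover have "det E = 1 + s * N"
    unfolding E_def det_identity_plus_rank_one
    by (simp add: N_def sum_distrib_left algebra_simps)
  moreover have "det D = d * a ^ (CARD('n) - 1)"
  proof -
    have "det D = (\<Prod>i\<in>UNIV. if i = k then d else a)"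
      by (subst det_diagonal) (auto simp: D_def)
    also have "\<dots> = d * (\<Prod>i\<in>UNIV - {k}. a)"
      by (subst prod.remove[of _ k]) auto
    finally show ?thesis by (simp add: card_Diff_singleton)
  qed
  ultimately have "det ?H = d * a ^ (CARD('n) - 1) * (1 + s * N)"
    unfolding fact by (simp add: det_mul det_transpose)
  \<comment> \<open>One factor \<open>a\<close> is split off so that, together with
    \<open>d\<close>, it clears the denominators in \<open>s\<close>.\<close>
  also have "CARD('n) - 1 = Suc (CARD('n) - 2)"
    using card2 by simp
  also have "d * a ^ Suc (CARD('n) - 2) * (1 + s * N) = a ^ (CARD('n) - 2) * (d * a + (s * a) * d * N)"
    by (simp add: algebra_simps)
  also have "s * a * d = b * d - c\<^sup>2"
    using \<open>a \<noteq> 0\<close> \<open>d \<noteq> 0\<close> by (simp add: s_def field_simps)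
  finally show ?thesis
    unfolding N_def[symmetric] by (simp add: algebra_simps)
qed

subsection \<open>Integration by parts\<close>

text \<open>Only differentiability along lines in direction \<open>i\<close> is asked, with the
  derivative named explicitly, so that the sum, product and chain rules are inherited from one real
  variable.\<close>

definition has_partial :: "'n \<Rightarrow> (real^'n \<Rightarrow> real) \<Rightarrow> (real^'n \<Rightarrow> real) \<Rightarrow> bool" where
  "has_partial i g g' \<longleftrightarrow>
     (\<forall>x. ((\<lambda>h. g (x + h *\<^sub>R axis i 1)) has_real_derivative g' x) (at 0))"

lemma has_partialD:
  assumes "has_partial i g g'"
  shows "((\<lambda>h. g (x + h *\<^sub>R axis i 1)) has_real_derivative g' (x + h *\<^sub>R axis i 1)) (at h)"
proof -
  have "((\<lambda>s. g ((x + h *\<^sub>R axis i 1) + s *\<^sub>R axis i 1))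
      has_real_derivative g' (x + h *\<^sub>R axis i 1)) (at 0)"
    using assms unfolding has_partial_def by blast
  then have "((\<lambda>s. (\<lambda>r. g (x + r *\<^sub>R axis i 1)) (h + s))
      has_real_derivative g' (x + h *\<^sub>R axis i 1)) (at 0)"
    by (simp add: algebra_simps)
  then show ?thesis
    using DERIV_shift[of "\<lambda>r. g (x + r *\<^sub>R axis i 1)" _ 0 h] by (simp add: add.commute)
qed

lemma has_partial_mult:
  assumes "has_partial i f f'" "has_partial i g g'"
  shows "has_partial i (\<lambda>x. f x * g x) (\<lambda>x. f' x * g x + f x * g' x)"
  unfolding has_partial_def
proof
  fix x
  show "((\<lambda>h. f (x + h *\<^sub>R axis i 1) * g (x + h *\<^sub>R axis i 1)) has_real_derivative
      f' x * g x + f x * g' x) (at 0)"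
    using DERIV_mult[OF has_partialD[OF assms(1), of x 0] has_partialD[OF assms(2), of x 0]]
    by (simp add: algebra_simps)
qed

lemma has_derivative_has_partial:
  assumes "\<And>x. (g has_derivative g' x) (at x)"
  shows "has_partial i g (\<lambda>x. g' x (axis i 1))"
  unfolding has_partial_def
proof
  fix x
  interpret bounded_linear "g' x"
    using assms has_derivative_bounded_linear by blast
  have "((\<lambda>h. g (x + h *\<^sub>R axis i 1)) has_derivative (\<lambda>h. g' x (h *\<^sub>R axis i 1))) (at 0)"
    by (rule has_derivative_compose[of "\<lambda>h. x + h *\<^sub>R axis i 1", where g = g])
       (auto intro!: derivative_eq_intros simp: assms)
  then show "((\<lambda>h. g (x + h *\<^sub>R axis i 1)) has_real_derivative g' x (axis i 1)) (at 0)"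
    by (simp add: has_field_derivative_def scaleR mult.commute[of _ "g' x (axis i 1)"])
qed

lemma differentiable_has_partial:
  assumes "\<And>x. g differentiable (at x)"
  shows "has_partial i g (partial i g)"
  unfolding partial_def[abs_def]
  by (rule has_derivative_has_partial, rule frechet_derivative_works[THEN iffD1], rule assms)

lemma integral_lborel_translation:
  fixes g :: "'a::euclidean_space \<Rightarrow> real"
  assumes "integrable lborel g"
  shows "integrable lborel (\<lambda>x. g (x + c))" "(LINT x|lborel. g (x + c)) = (LINT x|lborel. g x)"
proof -
  have [measurable]: "g \<in> borel_measurable borel"
    using borel_measurable_integrable[OF assms] by simp
  have "integrable (distr lborel borel ((+) c)) g"
    using assms by (simp add: lborel_distr_plus)
  then show "integrable lborel (\<lambda>x. g (x + c))"
    by (simp add: integrable_distr_eq add.commute)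
  have "(LINT x|lborel. g x) = (LINT x|distr lborel borel ((+) c). g x)"
    by (simp add: lborel_distr_plus)
  then show "(LINT x|lborel. g (x + c)) = (LINT x|lborel. g x)"
    by (simp add: integral_distr add.commute)
qed

lemma integrable_continuous_compact_support:
  fixes g :: "'a::euclidean_space \<Rightarrow> real"
  assumes "continuous_on UNIV g" "compact K" "\<And>x. x \<notin> K \<Longrightarrow> g x = 0"
  shows "integrable lborel g"
proof -
  have "integrable lborel (\<lambda>x. indicator K x *\<^sub>R g x)"
    by (rule borel_integrable_compact) (use assms continuous_on_subset in blast)+
  moreover have "(\<lambda>x. indicator K x *\<^sub>R g x) = g"
    using assms(3) by (auto simp: indicator_def fun_eq_iff)
  ultimately show ?thesis by simp
qed

text \<open>The difference quotients have integral zero by translation invariance.\<close>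

lemma integral_partial_eq_0:
  fixes g :: "real^'n \<Rightarrow> real"
  assumes gp: "has_partial i g g'" and cont: "continuous_on UNIV g" "continuous_on UNIV g'"
    and K: "compact K" "\<And>x. x \<notin> K \<Longrightarrow> g x = 0" "\<And>x. x \<notin> K \<Longrightarrow> g' x = 0"
  shows "(LINT x|lborel. g' x) = 0"
proof -
  define e :: "real^'n" where "e = axis i 1"
  have [measurable]: "g \<in> borel_measurable borel" "g' \<in> borel_measurable borel"
    using cont by (auto intro: borel_measurable_continuous_onI)
  define s where "s n x = (g (x + (1 / Suc n) *\<^sub>R e) - g x) * Suc n" for n x
  have "bounded (g' ` K)"
    using K(1) cont(2) by (meson compact_continuous_image compact_imp_bounded continuous_on_subset subset_UNIV)
  then obtain B where "\<And>x. x \<in> K \<Longrightarrow> \<bar>g' x\<bar> \<le> B"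
    by (auto simp: bounded_iff)
  then have B: "\<bar>g' x\<bar> \<le> max B 0" for x
    using K(3)[of x] by (cases "x \<in> K") fastforce+
  obtain R where R: "\<And>x. x \<in> K \<Longrightarrow> norm x \<le> R"
    using compact_imp_bounded[OF K(1)] by (auto simp: bounded_iff)
  have dq: "\<bar>g (x + h *\<^sub>R e) - g x\<bar> \<le> max B 0 * h" if h: "h > 0" for x h
  proof -
    obtain z where "g (x + h *\<^sub>R e) - g (x + 0 *\<^sub>R e) = (h - 0) * g' (x + z *\<^sub>R e)"
      using MVT2[OF h has_partialD[OF gp, of x]] unfolding e_def by blast
    then show ?thesis
      using h B[of "x + z *\<^sub>R e"] by (simp add: abs_mult mult.commute mult_left_mono)
  qed
  have "(\<lambda>n. LINT x|lborel. s n x) \<longlonglongrightarrow> (LINT x|lborel. g' x)"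
  \<comment> \<open>The mean value theorem bounds the quotients by \<open>max B 0\<close>, and steps
    of length at most 1 keep them supported in the ball of radius \<open>R + 1\<close>.\<close>
  proof (rule integral_dominated_convergence[where w = "\<lambda>x. max B 0 * indicator (cball 0 (R + 1)) x"])
    show "integrable lborel (\<lambda>x. max B 0 * indicator (cball (0::real^'n) (R + 1)) x)"
      by (intro integrable_mult_right integrable_real_indicator emeasure_lborel_cball_finite) auto
    show "AE x in lborel. norm (s n x) \<le> max B 0 * indicator (cball 0 (R + 1)) x" for n
    proof (rule AE_I2)
      fix x
      show "norm (s n x) \<le> max B 0 * indicator (cball 0 (R + 1)) x"
      proof (cases "norm x \<le> R + 1")
        case True
        have "\<bar>g (x + (1 / Suc n) *\<^sub>R e) - g x\<bar> * Suc n \<le> max B 0 * (1 / Suc n) * Suc n"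
          by (intro mult_right_mono dq) auto
        then show ?thesis using True by (simp add: s_def abs_mult)
      next
        case False
        have "norm x \<le> norm (x + (1 / Suc n) *\<^sub>R e) + norm ((1 / Suc n) *\<^sub>R e)"
          by (metis add_diff_cancel_right' norm_triangle_ineq4)
        also have "norm ((1 / Suc n) *\<^sub>R e) \<le> 1"
          by (simp add: e_def norm_axis_1)
        finally have "norm x \<le> norm (x + (1 / Suc n) *\<^sub>R e) + 1" by simp
        then have "x \<notin> K" "x + (1 / Suc n) *\<^sub>R e \<notin> K"
          using R[of x] R[of "x + (1 / Suc n) *\<^sub>R e"] False by (auto simp del: of_nat_Suc)
        then show ?thesis using False K(2) by (simp add: s_def)
      qed
    qed
    show "AE x in lborel. (\<lambda>n. s n x) \<longlonglongrightarrow> g' x"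
    proof (rule AE_I2)
      fix x
      have "((\<lambda>h. (g (x + h *\<^sub>R e) - g x) / h) \<longlongrightarrow> g' x) (at 0)"
        using has_partialD[OF gp, of x 0] by (simp add: has_field_derivative_iff e_def)
      moreover have "filterlim (\<lambda>n. 1 / real (Suc n)) (at 0) sequentially"
        using LIMSEQ_Suc[OF lim_1_over_n] by (simp add: filterlim_at del: of_nat_Suc)
      ultimately have "(\<lambda>n. (g (x + (1 / Suc n) *\<^sub>R e) - g x) / (1 / Suc n)) \<longlonglongrightarrow> g' x"
        by (rule filterlim_compose)
      then show "(\<lambda>n. s n x) \<longlonglongrightarrow> g' x" by (simp add: s_def)
    qed
  qed (auto simp: s_def)
  moreover have "(LINT x|lborel. s n x) = 0" for n
  proof -
    have "integrable lborel g"
      using integrable_continuous_compact_support cont(1) K(1,2) .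
    from integral_lborel_translation[OF this] this show ?thesis
      by (simp add: s_def)
  qed
  ultimately show ?thesis
    by (simp add: LIMSEQ_const_iff)
qed

text \<open>By the product rule the two integrands add up to a partial derivative of
  \<open>g \<psi>\<close>, which has compact support because \<open>\<psi>\<close> does.\<close>

lemma integration_by_parts_partial:
  fixes g :: "real^'n \<Rightarrow> real"
  assumes g: "has_partial i g g'" "continuous_on UNIV g" "continuous_on UNIV g'"
    and \<psi>: "has_partial i \<psi> \<psi>'" "continuous_on UNIV \<psi>" "continuous_on UNIV \<psi>'"
    and K: "compact K" "\<And>x. x \<notin> K \<Longrightarrow> \<psi> x = 0" "\<And>x. x \<notin> K \<Longrightarrow> \<psi>' x = 0"
  shows "(LINT x|lborel. g x * \<psi>' x) = - (LINT x|lborel. g' x * \<psi> x)"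
proof -
  have "(LINT x|lborel. g' x * \<psi> x + g x * \<psi>' x) = 0"
    by (rule integral_partial_eq_0[OF has_partial_mult[OF g(1) \<psi>(1)] _ _ K(1)])
       (use g \<psi> K in \<open>auto intro!: continuous_intros\<close>)
  moreover have "integrable lborel (\<lambda>x. g' x * \<psi> x)" "integrable lborel (\<lambda>x. g x * \<psi>' x)"
    by (rule integrable_continuous_compact_support[OF _ K(1)];
        use g \<psi> K in \<open>auto intro!: continuous_intros\<close>)+
  ultimately show ?thesis by simp
qed

text \<open>The complement of the support is open, so an iterated partial that vanishes on it has
  zero derivative there; the claim follows by induction on the order.\<close>

lemma partials_eq_0_outside_support:
  "x \<notin> closure {x. \<phi> x \<noteq> 0} \<Longrightarrow> partials is \<phi> x = 0"
proof (induction "is" arbitrary: x)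
  case Nil
  then show ?case using subsetD[OF closure_subset, of x "{x. \<phi> x \<noteq> 0}"] by auto
next
  case (Cons i "is")
  have "(partials is \<phi> has_derivative (\<lambda>_. 0)) (at x)"
  proof (rule has_derivative_transform_within_open)
    show "((\<lambda>_. 0 :: real) has_derivative (\<lambda>_. 0)) (at x)" by simp
    show "open (- closure {x. \<phi> x \<noteq> 0})" by (rule open_Compl) simp
    show "x \<in> - closure {x. \<phi> x \<noteq> 0}" using Cons.prems by simp
    show "0 = partials is \<phi> y" if "y \<in> - closure {x. \<phi> x \<noteq> 0}" for y
      using Cons.IH[of y] that by simp
  qed
  then have "frechet_derivative (partials is \<phi>) (at x) = (\<lambda>_. 0)"
    by (rule frechet_derivative_at[symmetric])
  then show ?case by (simp add: partial_def)
qed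

lemma test_functionD:
  assumes "test_function \<Omega> \<phi>"
  shows "has_partial i (partials is \<phi>) (partials (i # is) \<phi>)"
    and "continuous_on UNIV (partials is \<phi>)"
    and "\<exists>K. compact K \<and> K \<subseteq> \<Omega> \<and> (\<forall>js x. x \<notin> K \<longrightarrow> partials js \<phi> x = 0)"
proof -
  have *: "partials is \<phi> differentiable (at x)" for x
    using assms by (auto simp: test_function_def smooth_def)
  show "has_partial i (partials is \<phi>) (partials (i # is) \<phi>)"
    using differentiable_has_partial[OF *] by simp
  show "continuous_on UNIV (partials is \<phi>)"
    by (intro continuous_at_imp_continuous_on ballI differentiable_imp_continuous_within *)
  show "\<exists>K. compact K \<and> K \<subseteq> \<Omega> \<and> (\<forall>js x. x \<notin> K \<longrightarrow> partials js \<phi> x = 0)"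
    using assms partials_eq_0_outside_support[of _ \<phi>] unfolding test_function_def by blast
qed

text \<open>Test functions vanish outside \<Omega>, and Borel functions have the same integral over
  \<open>lebesgue\<close> and \<open>lborel\<close>, so the defining identity may be checked over
  the whole space in \<open>lborel\<close>.\<close>

lemma weak_derivI:
  assumes "Lq_loc 1 \<Omega> u" "Lq_loc 1 \<Omega> v"
    and [measurable]: "u \<in> borel_measurable borel" "v \<in> borel_measurable borel"
    and "\<And>\<phi>. test_function \<Omega> \<phi> \<Longrightarrow>
      (LINT x|lborel. u x * partials is \<phi> x) = (-1) ^ length is * (LINT x|lborel. v x * \<phi> x)"
  shows "weak_deriv \<Omega> is u v"
  unfolding weak_deriv_def
proof (intro conjI allI impI assms(1,2))
  fix \<phi> assume \<phi>: "test_function \<Omega> \<phi>"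
  obtain K where K: "K \<subseteq> \<Omega>" "\<And>js x. x \<notin> K \<Longrightarrow> partials js \<phi> x = 0"
    using test_functionD(3)[OF \<phi>] by blast
  have *: "(LINT x:\<Omega>|lebesgue. w x * partials js \<phi> x) = (LINT x|lborel. w x * partials js \<phi> x)"
    if [measurable]: "w \<in> borel_measurable borel" for w js
  proof -
    have [measurable]: "partials js \<phi> \<in> borel_measurable borel"
      by (rule borel_measurable_continuous_onI) (rule test_functionD(2)[OF \<phi>])
    have "(LINT x:\<Omega>|lebesgue. w x * partials js \<phi> x) = (LINT x|lebesgue. w x * partials js \<phi> x)"
      unfolding set_lebesgue_integral_def
      by (rule Bochner_Integration.integral_cong) (use K in \<open>auto simp: indicator_def\<close>)
    also have "\<dots> = (LINT x|lborel. w x * partials js \<phi> x)"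
      by (rule integral_completion) measurable
    finally show ?thesis .
  qed
  show "(LINT x:\<Omega>|lebesgue. u x * partials is \<phi> x) =
      (- 1) ^ length is * (LINT x:\<Omega>|lebesgue. v x * \<phi> x)"
    using assms(5)[OF \<phi>] *[of u "is"] *[of v "[]"] by simp
qed

section \<open>Differentiation rules along a coordinate direction\<close>

lemma has_partial_cong:
  "has_partial i g g' \<Longrightarrow> (\<And>x. g' x = h' x) \<Longrightarrow> has_partial i g h'"
  by (simp add: has_partial_def)

lemma has_partial_const: "has_partial i (\<lambda>_. c) (\<lambda>_. 0)"
  by (simp add: has_partial_def)

lemma has_partial_add:
  assumes "has_partial i f f'" "has_partial i g g'"
  shows "has_partial i (\<lambda>x. f x + g x) (\<lambda>x. f' x + g' x)"
  using assms unfolding has_partial_def by (auto intro: DERIV_add)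

lemma has_partial_sum:
  assumes "\<And>j. j \<in> J \<Longrightarrow> has_partial i (f j) (f' j)"
  shows "has_partial i (\<lambda>x. \<Sum>j\<in>J. f j x) (\<lambda>x. \<Sum>j\<in>J. f' j x)"
  using assms unfolding has_partial_def by (auto intro: DERIV_sum)

lemma has_partial_component: "has_partial i (\<lambda>x. x $ j) (\<lambda>_. if i = j then 1 else 0)"
  unfolding has_partial_def
  by (auto simp: axis_def intro!: derivative_eq_intros)

lemma has_partial_chain:
  assumes "has_partial i g g'" "\<And>x. (f has_real_derivative f' (g x)) (at (g x))"
  shows "has_partial i (\<lambda>x. f (g x)) (\<lambda>x. f' (g x) * g' x)"
  unfolding has_partial_def
proof
  fix x
  show "((\<lambda>h. f (g (x + h *\<^sub>R axis i 1))) has_real_derivative f' (g x) * g' x) (at 0)"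
    by (rule DERIV_chain2[of f _ "\<lambda>h. g (x + h *\<^sub>R axis i 1)"])
       (use assms in \<open>auto simp: has_partial_def\<close>)
qed

subsection \<open>Bump functions\<close>

text \<open>For \<open>m = 0\<close> this is the standard smooth function that is flat at 0. The
  powers of \<open>1 / t\<close> make the family closed under differentiation up to linear
  combinations.\<close>

definition flat_exp :: "nat \<Rightarrow> real \<Rightarrow> real" where
  "flat_exp m t = (if t > 0 then (1 / t) ^ m * exp (- (1 / t)) else 0)"

text \<open>From the right, \<open>1 / t\<close> tends to infinity, where the exponential beats
  every power; from the left the function is 0.\<close>

lemma flat_exp_tendsto_0: "(flat_exp m \<longlongrightarrow> 0) (at 0)"
proof -
  have "((\<lambda>t. inverse t ^ m / exp (inverse t)) \<longlongrightarrow> 0) (at_right (0::real))"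
    by (rule filterlim_compose[OF tendsto_power_div_exp_0 filterlim_inverse_at_top_right])
  moreover have "eventually (\<lambda>t. inverse t ^ m / exp (inverse t) = flat_exp m t) (at_right 0)"
    by (simp add: eventually_at_filter flat_exp_def exp_minus field_simps inverse_eq_divide)
  ultimately have "(flat_exp m \<longlongrightarrow> 0) (at_right 0)"
    by (rule Lim_transform_eventually)
  moreover have "(flat_exp m \<longlongrightarrow> 0) (at_left 0)"
    by (rule tendsto_eventually) (simp add: eventually_at_filter flat_exp_def)
  ultimately show ?thesis
    by (simp add: filterlim_split_at)
qed

lemma has_real_derivative_flat_exp:
  "(flat_exp m has_real_derivative flat_exp (m + 2) t - m * flat_exp (m + 1) t) (at t)"
proof -
  consider "t > 0" | "t < 0" | "t = 0" by linarith
  then show ?thesis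
  proof cases
    case 1
    have "((\<lambda>t. (1 / t) ^ m * exp (- (1 / t))) has_real_derivative
        flat_exp (m + 2) t - m * flat_exp (m + 1) t) (at t)"
    proof -
      have inv: "((\<lambda>t. 1 / t) has_real_derivative - ((1 / t)\<^sup>2)) (at t)"
        using 1 by (auto intro!: derivative_eq_intros simp: power2_eq_square)
      show ?thesis
        by (rule DERIV_cong[OF DERIV_mult[OF DERIV_power[OF inv] DERIV_fun_exp[OF DERIV_minus[OF inv]]]])
           (use 1 in \<open>cases m; simp add: flat_exp_def power2_eq_square algebra_simps\<close>)
    qed
    then show ?thesis
      by (rule DERIV_cong_ev[THEN iffD1, rotated 3])
         (use 1 in \<open>auto simp: flat_exp_def eventually_nhds intro!: exI[of _ "{0<..}"]\<close>)
  next
    case 2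
    have "((\<lambda>_. 0) has_real_derivative 0) (at t)" by simp
    then have "(flat_exp m has_real_derivative 0) (at t)"
      by (rule DERIV_cong_ev[THEN iffD1, rotated 3])
         (use 2 in \<open>auto simp: flat_exp_def eventually_nhds intro!: exI[of _ "{..<0}"]\<close>)
    then show ?thesis using 2 by (simp add: flat_exp_def)
  next
    case 3
    \<comment> \<open>The difference quotient at 0 is itself \<open>flat_exp (m + 1)\<close>, which
      tends to 0.\<close>
    have "((\<lambda>y. (flat_exp m y - flat_exp m 0) / (y - 0)) \<longlongrightarrow> 0) (at 0)"
      by (rule Lim_transform_eventually[OF flat_exp_tendsto_0[of "m + 1"]])
         (auto simp: eventually_at_filter flat_exp_def)
    then show ?thesis
      using 3 by (simp add: has_field_derivative_iff flat_exp_def)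
  qed
qed

text \<open>A class of functions that is closed under partial derivatives and contains bump functions.\<close>

inductive flat_exp_algebra :: "(real^'n \<Rightarrow> real) \<Rightarrow> bool" where
  const: "flat_exp_algebra (\<lambda>_. c)"
| component: "flat_exp_algebra (\<lambda>x. x $ i)"
| add: "flat_exp_algebra f \<Longrightarrow> flat_exp_algebra g \<Longrightarrow> flat_exp_algebra (\<lambda>x. f x + g x)"
| mult: "flat_exp_algebra f \<Longrightarrow> flat_exp_algebra g \<Longrightarrow> flat_exp_algebra (\<lambda>x. f x * g x)"
| flat: "flat_exp_algebra f \<Longrightarrow> flat_exp_algebra (\<lambda>x. flat_exp m (f x))"

text \<open>Induction over the construction. In the case \<open>flat\<close>, the chain rule
  produces \<open>flat_exp (m + 2)\<close> and \<open>flat_exp (m + 1)\<close> of the same inner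
  function, which is why the class admits every index \<open>m\<close>.\<close>

lemma flat_exp_algebra_derivative:
  "flat_exp_algebra f \<Longrightarrow>
    \<exists>f'. (\<forall>x. (f has_derivative f' x) (at x)) \<and> (\<forall>i. flat_exp_algebra (\<lambda>x. f' x (axis i 1)))"
proof (induction rule: flat_exp_algebra.induct)
  case (const c)
  show ?case by (rule exI[of _ "\<lambda>_ _. 0"]) (auto intro: flat_exp_algebra.const)
next
  case (component i)
  show ?case
    by (rule exI[of _ "\<lambda>_ v. v $ i"])
       (auto intro: flat_exp_algebra.const bounded_linear_imp_has_derivative bounded_linear_vec_nth)
next
  case (add f g)
  then obtain f' g' where "\<forall>x. (f has_derivative f' x) (at x)" "\<forall>i. flat_exp_algebra (\<lambda>x. f' x (axis i 1))"
    "\<forall>x. (g has_derivative g' x) (at x)" "\<forall>i. flat_exp_algebra (\<lambda>x. g' x (axis i 1))" by blast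
  then show ?case
    by (intro exI[of _ "\<lambda>x v. f' x v + g' x v"])
       (auto intro: flat_exp_algebra.add has_derivative_add)
next
  case (mult f g)
  then obtain f' g' where "\<forall>x. (f has_derivative f' x) (at x)" "\<forall>i. flat_exp_algebra (\<lambda>x. f' x (axis i 1))"
    "\<forall>x. (g has_derivative g' x) (at x)" "\<forall>i. flat_exp_algebra (\<lambda>x. g' x (axis i 1))" by blast
  then show ?case
    using mult.hyps
    by (intro exI[of _ "\<lambda>x v. f x * g' x v + f' x v * g x"] conjI allI
        flat_exp_algebra.add flat_exp_algebra.mult has_derivative_mult) auto
next
  case (flat f m)
  then obtain f' where f': "\<forall>x. (f has_derivative f' x) (at x)" "\<forall>i. flat_exp_algebra (\<lambda>x. f' x (axis i 1))"
    by blast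
  define d where "d x = flat_exp (m + 2) (f x) + (- real m) * flat_exp (m + 1) (f x)" for x
  have "flat_exp_algebra d"
    unfolding d_def[abs_def]
    by (intro flat_exp_algebra.add flat_exp_algebra.mult flat_exp_algebra.const flat_exp_algebra.flat flat.hyps)
  moreover have "((\<lambda>x. flat_exp m (f x)) has_derivative (\<lambda>v. d x * f' x v)) (at x)" for x
  proof -
    have "(flat_exp m has_derivative (\<lambda>s. d x * s)) (at (f x))"
      using has_real_derivative_flat_exp[of m "f x"] by (simp add: has_field_derivative_def d_def)
    from has_derivative_compose[OF f'(1)[rule_format, of x] this] show ?thesis .
  qed
  ultimately show ?case
    using f'(2) by (intro exI[of _ "\<lambda>x v. d x * f' x v"]) (auto intro: flat_exp_algebra.mult)
qed

lemma flat_exp_algebra_sum: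
  "finite A \<Longrightarrow> (\<And>i. i \<in> A \<Longrightarrow> flat_exp_algebra (f i)) \<Longrightarrow> flat_exp_algebra (\<lambda>x. \<Sum>i\<in>A. f i x)"
  by (induction A rule: finite_induct) (auto intro: flat_exp_algebra.const flat_exp_algebra.add)

lemma flat_exp_algebra_smooth:
  assumes "flat_exp_algebra f"
  shows "smooth f"
proof -
  have "flat_exp_algebra (partials is f)" for "is"
  proof (induction "is")
    case (Cons i "is")
    then obtain f' where f': "\<forall>x. (partials is f has_derivative f' x) (at x)"
      "flat_exp_algebra (\<lambda>x. f' x (axis i 1))"
      using flat_exp_algebra_derivative by blast
    then have "partials (i # is) f = (\<lambda>x. f' x (axis i 1))"
      by (simp add: partial_def fun_eq_iff) (metis frechet_derivative_at)
    then show ?case using f'(2) by simp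
  qed (use assms in simp)
  then show ?thesis
    unfolding smooth_def differentiable_def using flat_exp_algebra_derivative by blast
qed

text \<open>The function is supported in the ellipsoid with centre \<open>c\<close> and half-axes
  \<open>1 / s i\<close>; separate scales are needed because the cells used later are long along the
  axis and thin across it.\<close>

definition bump :: "('n \<Rightarrow> real) \<Rightarrow> (real^'n) \<Rightarrow> real^'n \<Rightarrow> real" where
  "bump s c x = flat_exp 0 (1 - (\<Sum>i\<in>UNIV. (s i * (x $ i - c $ i))\<^sup>2))"

lemma smooth_bump: "smooth (bump s c)"
proof (rule flat_exp_algebra_smooth)
  have "flat_exp_algebra (\<lambda>x. flat_exp 0 (1 + (-1) * (\<Sum>i\<in>UNIV. (s i * (x $ i + - (c $ i))) * (s i * (x $ i + - (c $ i))))))"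
    by (intro flat_exp_algebra.intros flat_exp_algebra_sum finite)
  then show "flat_exp_algebra (bump s c)"
    by (simp add: bump_def[abs_def] power2_eq_square)
qed

lemma bump_bounds: "0 \<le> bump s c x" "bump s c x \<le> 1"
  by (simp_all add: bump_def flat_exp_def)

lemma bump_eq_0:
  assumes "\<bar>s i * (x $ i - c $ i)\<bar> > 1"
  shows "bump s c x = 0"
proof -
  have "1 < (s i * (x $ i - c $ i))\<^sup>2"
    using assms one_less_power[of "\<bar>s i * (x $ i - c $ i)\<bar>" 2] by simp
  also have "\<dots> \<le> (\<Sum>i\<in>UNIV. (s i * (x $ i - c $ i))\<^sup>2)"
    by (rule member_le_sum) auto
  finally show ?thesis by (simp add: bump_def flat_exp_def)
qed

text \<open>With \<open>n\<close> coordinates the sum of squares is at most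
  \<open>n / (2n)^2 = 1 / (4n)\<close>, hence at most 1/2, and \<open>flat_exp 0\<close> at an
  argument of at least 1/2 is at least \<open>exp (- 2)\<close>.\<close>

lemma bump_ge:
  fixes c :: "real^'n"
  assumes "\<And>i. \<bar>s i * (x $ i - c $ i)\<bar> \<le> 1 / (2 * real CARD('n))"
  shows "bump s c x \<ge> exp (- 2)"
proof -
  let ?N = "real CARD('n)"
  have N: "?N \<ge> 1" using zero_less_card_finite[where 'a = 'n] by linarith
  have "(\<Sum>i\<in>UNIV. (s i * (x $ i - c $ i))\<^sup>2) \<le> (\<Sum>i\<in>(UNIV::'n set). (1 / (2 * ?N))\<^sup>2)"
  proof (rule sum_mono)
    fix i
    have "\<bar>s i * (x $ i - c $ i)\<bar>\<^sup>2 \<le> (1 / (2 * ?N))\<^sup>2"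
      using assms[of i] by (intro power_mono) auto
    then show "(s i * (x $ i - c $ i))\<^sup>2 \<le> (1 / (2 * ?N))\<^sup>2" by simp
  qed
  also have "\<dots> = 1 / (4 * ?N)" using N by (simp add: power2_eq_square field_simps)
  also have "\<dots> \<le> 1 / 2"
    by (rule divide_left_mono) (use N in linarith)+
  finally have *: "1/2 \<le> 1 - (\<Sum>i\<in>UNIV. (s i * (x $ i - c $ i))\<^sup>2)" (is "_ \<le> ?t") by simp
  then have "1 / ?t \<le> 1 / (1/2)" by (intro divide_left_mono) auto
  then show ?thesis using * by (simp add: bump_def flat_exp_def)
qed

subsection \<open>Pogorelov's function\<close>

locale pogorelov =
  fixes k :: "'n::finite"
  assumes card_ge_4: "CARD('n) \<ge> 4"
begin

text \<open>Since \<open>rad2\<close> is the square of the distance to the axis, this is half of the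
  exponent \<open>2 - 2/n\<close>.\<close>

definition \<beta> :: real where "\<beta> = 1 - 1 / real CARD('n)"

definition rad2 :: "real^'n \<Rightarrow> real" where "rad2 x = (\<Sum>i\<in>UNIV - {k}. (x $ i)\<^sup>2)"

text \<open>For \<open>\<epsilon> > 0\<close> the functions \<open>G \<epsilon> i\<close> and \<open>H \<epsilon> i j\<close> are the classical partial derivatives of the smooth
  function \<open>U \<epsilon>\<close>.  For \<open>\<epsilon> = 0\<close> the convention \<open>0 powr p = 0\<close> gives all of them the value \<open>0\<close> on the axis.\<close>

definition rpow :: "real \<Rightarrow> real \<Rightarrow> real^'n \<Rightarrow> real" where
  "rpow \<epsilon> p x = (rad2 x + \<epsilon>) powr p"

definition U :: "real \<Rightarrow> real^'n \<Rightarrow> real" where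
  "U \<epsilon> x = rpow \<epsilon> \<beta> x * (1 + (x $ k)\<^sup>2)"

definition G :: "real \<Rightarrow> 'n \<Rightarrow> real^'n \<Rightarrow> real" where
  "G \<epsilon> i x = (if i = k then rpow \<epsilon> \<beta> x * (2 * x $ k)
     else 2 * \<beta> * x $ i * rpow \<epsilon> (\<beta> - 1) x * (1 + (x $ k)\<^sup>2))"

definition H :: "real \<Rightarrow> 'n \<Rightarrow> 'n \<Rightarrow> real^'n \<Rightarrow> real" where
  "H \<epsilon> i j x =
     (if i = k \<and> j = k then 2 * rpow \<epsilon> \<beta> x
      else if j = k then 4 * \<beta> * x $ k * rpow \<epsilon> (\<beta> - 1) x * x $ i
      else if i = k then 4 * \<beta> * x $ k * rpow \<epsilon> (\<beta> - 1) x * x $ j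
      else (if i = j then 2 * \<beta> * rpow \<epsilon> (\<beta> - 1) x * (1 + (x $ k)\<^sup>2) else 0) +
        4 * \<beta> * (\<beta> - 1) * rpow \<epsilon> (\<beta> - 2) x * (1 + (x $ k)\<^sup>2) * x $ i * x $ j)"

lemma \<beta>_bounds: "3/4 \<le> \<beta>" "\<beta> < 1"
  using card_ge_4 by (simp_all add: \<beta>_def field_simps)

lemma rad2_nonneg: "rad2 x \<ge> 0"
  by (simp add: rad2_def sum_nonneg)

lemma component_le_rad2: "i \<noteq> k \<Longrightarrow> (x $ i)\<^sup>2 \<le> rad2 x"
  unfolding rad2_def by (rule member_le_sum) auto

lemma rad2_le_norm: "rad2 x \<le> (norm x)\<^sup>2"
proof -
  have "rad2 x \<le> (\<Sum>i\<in>UNIV. (x $ i)\<^sup>2)"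
    unfolding rad2_def by (rule sum_mono2) auto
  then show ?thesis
    by (simp add: norm_vec_def L2_set_def sum_nonneg)
qed

lemma continuous_on_rad2 [continuous_intros]: "continuous_on A rad2"
  unfolding rad2_def by (intro continuous_intros)

lemma measurable_rad2 [measurable]: "rad2 \<in> borel_measurable borel"
  by (rule borel_measurable_continuous_onI) (rule continuous_on_rad2)

lemma measurable_component [measurable]: "(\<lambda>x::real^'n. x $ i) \<in> borel_measurable borel"
  by (rule borel_measurable_continuous_onI) (intro continuous_intros)

lemma measurable_derivs [measurable]:
  "U \<epsilon> \<in> borel_measurable borel" "G \<epsilon> i \<in> borel_measurable borel" "H \<epsilon> i j \<in> borel_measurable borel"
  unfolding U_def G_def H_def rpow_def by measurable

lemma continuous_on_rpow: "\<epsilon> > 0 \<Longrightarrow> continuous_on A (rpow \<epsilon> p)"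
  unfolding rpow_def using rad2_nonneg by (intro continuous_intros) (auto simp: add_nonneg_eq_0_iff)

lemma continuous_on_derivs:
  assumes "\<epsilon> > 0"
  shows "continuous_on A (U \<epsilon>)" "continuous_on A (G \<epsilon> i)" "continuous_on A (H \<epsilon> i j)"
proof -
  have if_cont: "continuous_on A (\<lambda>x. if c then f x else g x)"
    if "continuous_on A f" "continuous_on A g" for c and f g :: "real^'n \<Rightarrow> real"
    using that by (cases c) simp_all
  show "continuous_on A (U \<epsilon>)" "continuous_on A (G \<epsilon> i)" "continuous_on A (H \<epsilon> i j)"
    unfolding U_def G_def H_def
    by (intro if_cont continuous_on_mult continuous_on_add continuous_on_const continuous_on_power
        continuous_on_component continuous_on_id continuous_on_rpow assms)+
qed

lemma has_partial_rad2: "has_partial i rad2 (\<lambda>x. if i = k then 0 else 2 * x $ i)"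
proof -
  have "has_partial i rad2
      (\<lambda>x. \<Sum>j\<in>UNIV - {k}. (if i = j then 1 else 0) * x $ j + x $ j * (if i = j then 1 else 0))"
    unfolding rad2_def power2_eq_square
    by (intro has_partial_sum has_partial_mult has_partial_component)
  then show ?thesis
    by (rule has_partial_cong) (auto simp: sum.distrib if_distrib[of "\<lambda>a. a * _"] if_distrib[of "\<lambda>a. _ * a"] cong: if_cong)
qed

lemma has_partial_rpow:
  assumes "\<epsilon> > 0"
  shows "has_partial i (rpow \<epsilon> p) (\<lambda>x. if i = k then 0 else 2 * p * x $ i * rpow \<epsilon> (p - 1) x)"
proof -
  have pos: "rad2 x + \<epsilon> > 0" for x
    using assms rad2_nonneg[of x] by linarith
  have "has_partial i (\<lambda>x. rad2 x + \<epsilon>) (\<lambda>x. (if i = k then 0 else 2 * x $ i) + 0)"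
    by (intro has_partial_add has_partial_rad2 has_partial_const)
  from has_partial_chain[OF this has_real_derivative_powr[OF pos, of p]] show ?thesis
    unfolding rpow_def[abs_def] by (rule has_partial_cong) auto
qed

lemma has_partial_axial:
  "has_partial i (\<lambda>x. 1 + (x $ k)\<^sup>2) (\<lambda>x. if i = k then 2 * x $ k else 0)"
  using has_partial_add[OF has_partial_const[of i 1]
      has_partial_mult[OF has_partial_component[of i k] has_partial_component[of i k]]]
  unfolding power2_eq_square by (rule has_partial_cong) auto

lemma has_partial_U:
  assumes "\<epsilon> > 0"
  shows "has_partial i (U \<epsilon>) (G \<epsilon> i)"
  unfolding U_def[abs_def]
  by (rule has_partial_cong[OF has_partial_mult[OF has_partial_rpow[OF assms] has_partial_axial]])
     (auto simp: G_def)

lemma has_partial_G: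
  assumes "\<epsilon> > 0"
  shows "has_partial i (G \<epsilon> j) (H \<epsilon> i j)"
proof (cases "j = k")
  case True
  have "has_partial i (\<lambda>x. rpow \<epsilon> \<beta> x * (2 * x $ k)) (H \<epsilon> i j)"
    by (rule has_partial_cong[OF has_partial_mult[OF has_partial_rpow[OF assms]
          has_partial_mult[OF has_partial_const has_partial_component]]])
       (auto simp: H_def True)
  then show ?thesis using True by (simp add: G_def[abs_def])
next
  case False
  have "has_partial i (\<lambda>x. 2 * \<beta> * x $ j * rpow \<epsilon> (\<beta> - 1) x * (1 + (x $ k)\<^sup>2)) (H \<epsilon> i j)"
    by (rule has_partial_cong[OF has_partial_mult[OF has_partial_mult[OF
          has_partial_mult[OF has_partial_const has_partial_component] has_partial_rpow[OF assms]] has_partial_axial]])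
       (use False in \<open>auto simp: H_def algebra_simps\<close>)
  then show ?thesis using False by (simp add: G_def[abs_def])
qed

text \<open>The exponent \<open>\<beta> - 1\<close> is negative, so adding \<epsilon> to
  \<open>rad2\<close> only lowers that power; this makes the bound uniform in \<epsilon>. It
  provides the dominating function for the limit \<epsilon> to 0 and, at \<epsilon> = 0 itself,
  local integrability.\<close>

lemma derivs_bound:
  assumes "norm x \<le> R" "0 \<le> \<epsilon>" "\<epsilon> \<le> 1" "rad2 x > 0"
  shows "\<bar>U \<epsilon> x\<bar> \<le> 8 * (2 + R\<^sup>2)\<^sup>2 * rad2 x powr (\<beta> - 1)"
    and "\<bar>G \<epsilon> i x\<bar> \<le> 8 * (2 + R\<^sup>2)\<^sup>2 * rad2 x powr (\<beta> - 1)"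
    and "\<bar>H \<epsilon> i j x\<bar> \<le> 8 * (2 + R\<^sup>2)\<^sup>2 * rad2 x powr (\<beta> - 1)"
proof -
  \<comment> \<open>One constant that bounds every \<open>\<bar>x $ l\<bar>\<close>, the factor
    \<open>1 + (x $ k)\<^sup>2\<close> and the regularised \<open>s\<close>.\<close>
  define M where "M = 2 + R\<^sup>2"
  define p where "p = rad2 x powr (\<beta> - 1)"
  define s where "s = rad2 x + \<epsilon>"
  have "s > 0" using assms by (simp add: s_def)
  have "M \<ge> 1" "p \<ge> 0" by (simp_all add: M_def p_def)
  have R2: "(norm x)\<^sup>2 \<le> R\<^sup>2" using assms(1) by (simp add: power_mono)
  have comp2: "(x $ l)\<^sup>2 \<le> R\<^sup>2" for l
    using assms(1) component_le_norm_cart[of x l] by (metis abs_ge_zero order_trans power2_abs power_mono)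
  have comp: "\<bar>x $ l\<bar> \<le> M" for l
    using comp2[of l] sum_squares_bound[of "\<bar>x $ l\<bar>" 1] unfolding M_def by simp
  have axial: "0 \<le> 1 + (x $ k)\<^sup>2" "1 + (x $ k)\<^sup>2 \<le> M" "1 \<le> M"
    using comp2[of k] by (auto simp: M_def)
  have "s \<le> M" using rad2_le_norm[of x] R2 assms by (simp add: s_def M_def)
  have p1: "s powr (\<beta> - 1) \<le> p"
    unfolding p_def by (rule powr_mono2') (use assms \<beta>_bounds in \<open>auto simp: s_def\<close>)
  have "s powr \<beta> = s * s powr (\<beta> - 1)"
    using \<open>s > 0\<close> by (simp add: powr_mult_base)
  also have "\<dots> \<le> M * p"
    using p1 \<open>s \<le> M\<close> \<open>s > 0\<close> \<open>p \<ge> 0\<close> by (intro mult_mono) auto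
  finally have p0: "s powr \<beta> \<le> M * p" .
  have prod: "\<bar>x $ i * x $ j\<bar> \<le> s" if "i \<noteq> k" "j \<noteq> k" for i j
  proof -
    have "2 * \<bar>x $ i * x $ j\<bar> \<le> (x $ i)\<^sup>2 + (x $ j)\<^sup>2"
      using sum_squares_bound[of "\<bar>x $ i\<bar>" "\<bar>x $ j\<bar>"] by (simp add: abs_mult)
    then show ?thesis
      using component_le_rad2[OF that(1), of x] component_le_rad2[OF that(2), of x] assms
      by (simp add: s_def)
  qed
  \<comment> \<open>The more singular power \<open>\<beta> - 2\<close> occurs only with two
    transverse coordinates, whose product is at most \<open>s\<close> and restores the exponent
    \<open>\<beta> - 1\<close>.\<close>
  have p2: "\<bar>x $ i * x $ j\<bar> * s powr (\<beta> - 2) \<le> p" if "i \<noteq> k" "j \<noteq> k" for i j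
  proof -
    have "\<bar>x $ i * x $ j\<bar> * s powr (\<beta> - 2) \<le> s * s powr (\<beta> - 2)"
      using prod[OF that] by (intro mult_right_mono) auto
    also have "\<dots> = s powr (\<beta> - 1)"
      using \<open>s > 0\<close> by (simp add: powr_mult_base)
    finally show ?thesis using p1 by simp
  qed
  have "M \<le> M\<^sup>2" using axial by (simp add: power2_eq_square)
  then have Mp: "M * p \<le> M\<^sup>2 * p" "p \<le> M\<^sup>2 * p"
    using mult_right_mono[of M "M\<^sup>2" p] mult_right_mono[of 1 "M\<^sup>2" p] \<open>p \<ge> 0\<close> axial by auto
  have pos: "0 \<le> M\<^sup>2 * p" using \<open>p \<ge> 0\<close> by simp
  have "\<bar>U \<epsilon> x\<bar> = s powr \<beta> * (1 + (x $ k)\<^sup>2)"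
    using axial by (simp add: U_def rpow_def s_def abs_mult)
  also have "\<dots> \<le> (M * p) * M"
    using p0 axial \<open>p \<ge> 0\<close> by (intro mult_mono) auto
  finally show "\<bar>U \<epsilon> x\<bar> \<le> 8 * (2 + R\<^sup>2)\<^sup>2 * rad2 x powr (\<beta> - 1)"
    unfolding M_def[symmetric] p_def[symmetric] using pos
    by (simp add: power2_eq_square algebra_simps)
  have Gk: "\<bar>s powr \<beta> * (2 * x $ k)\<bar> \<le> (M * p) * (2 * M)"
    unfolding abs_mult using p0 comp[of k] \<open>p \<ge> 0\<close> axial by (intro mult_mono) auto
  have Gi: "\<bar>2 * \<beta> * x $ i * s powr (\<beta> - 1) * (1 + (x $ k)\<^sup>2)\<bar> \<le> 2 * 1 * M * p * M" for i
    unfolding abs_mult using p1 comp[of i] \<open>p \<ge> 0\<close> axial \<beta>_bounds by (intro mult_mono) auto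
  show "\<bar>G \<epsilon> i x\<bar> \<le> 8 * (2 + R\<^sup>2)\<^sup>2 * rad2 x powr (\<beta> - 1)"
    unfolding M_def[symmetric] p_def[symmetric] G_def rpow_def s_def[symmetric]
    using Gk Gi[of i] pos by (simp add: power2_eq_square algebra_simps)
  have Hkk: "\<bar>2 * s powr \<beta>\<bar> \<le> 2 * (M * p)"
    using p0 by simp
  have Hik: "\<bar>4 * \<beta> * x $ k * s powr (\<beta> - 1) * x $ i\<bar> \<le> 4 * 1 * M * p * M" for i
    unfolding abs_mult using p1 comp[of i] comp[of k] \<open>p \<ge> 0\<close> axial \<beta>_bounds by (intro mult_mono) auto
  have Hd: "\<bar>2 * \<beta> * s powr (\<beta> - 1) * (1 + (x $ k)\<^sup>2)\<bar> \<le> 2 * 1 * p * M"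
    unfolding abs_mult using p1 \<open>p \<ge> 0\<close> axial \<beta>_bounds by (intro mult_mono) auto
  have Hij: "\<bar>4 * \<beta> * (\<beta> - 1) * s powr (\<beta> - 2) * (1 + (x $ k)\<^sup>2) * x $ i * x $ j\<bar> \<le> 4 * M * p"
    if "i \<noteq> k" "j \<noteq> k" for i j
  proof -
    have "\<bar>4 * \<beta> * (\<beta> - 1) * s powr (\<beta> - 2) * (1 + (x $ k)\<^sup>2) * x $ i * x $ j\<bar>
        = 4 * \<beta> * (1 - \<beta>) * (1 + (x $ k)\<^sup>2) * (\<bar>x $ i * x $ j\<bar> * s powr (\<beta> - 2))"
      using \<beta>_bounds axial by (simp add: abs_mult)
    also have "\<dots> \<le> 4 * 1 * 1 * M * p"
      using p2[OF that] axial \<beta>_bounds \<open>p \<ge> 0\<close> by (intro mult_mono) auto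
    finally show ?thesis by simp
  qed
  show "\<bar>H \<epsilon> i j x\<bar> \<le> 8 * (2 + R\<^sup>2)\<^sup>2 * rad2 x powr (\<beta> - 1)"
    unfolding M_def[symmetric] p_def[symmetric] H_def rpow_def s_def[symmetric]
  proof -
    consider "i = k" "j = k" | "i \<noteq> k" "j = k" | "i = k" "j \<noteq> k" | "i \<noteq> k" "j \<noteq> k" by blast
    then show "\<bar>if i = k \<and> j = k then 2 * s powr \<beta>
      else if j = k then 4 * \<beta> * x $ k * s powr (\<beta> - 1) * x $ i
      else if i = k then 4 * \<beta> * x $ k * s powr (\<beta> - 1) * x $ j
      else (if i = j then 2 * \<beta> * s powr (\<beta> - 1) * (1 + (x $ k)\<^sup>2) else 0) +
        4 * \<beta> * (\<beta> - 1) * s powr (\<beta> - 2) * (1 + (x $ k)\<^sup>2) * x $ i * x $ j\<bar> \<le> 8 * M\<^sup>2 * p"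
    proof cases
      case 1
      then show ?thesis using Hkk Mp pos by (simp add: algebra_simps)
    next
      case 2
      from 2 have "\<bar>4 * \<beta> * x $ k * s powr (\<beta> - 1) * x $ i\<bar> \<le> 4 * (M\<^sup>2 * p)"
        using Hik[of i] by (simp only: power2_eq_square mult_ac)
      with 2 pos show ?thesis by simp
    next
      case 3
      from 3 have "\<bar>4 * \<beta> * x $ k * s powr (\<beta> - 1) * x $ j\<bar> \<le> 4 * (M\<^sup>2 * p)"
        using Hik[of j] by (simp only: power2_eq_square mult_ac)
      with 3 pos show ?thesis by simp
    next
      case 4
      have "\<bar>if i = j then 2 * \<beta> * s powr (\<beta> - 1) * (1 + (x $ k)\<^sup>2) else 0\<bar> \<le> 2 * M\<^sup>2 * p"
        using Hd Mp pos by (simp add: mult.commute)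
      moreover have "4 * M * p \<le> 4 * M\<^sup>2 * p" using Mp by simp
      ultimately show ?thesis
        using 4 by (simp only: if_False simp_thms) (use Hij[OF 4] pos in linarith)
    qed
  qed
qed

lemma derivs_tendsto:
  assumes "rad2 x > 0"
  shows "(\<lambda>n. U (1 / Suc n) x) \<longlonglongrightarrow> U 0 x" "(\<lambda>n. G (1 / Suc n) i x) \<longlonglongrightarrow> G 0 i x"
    "(\<lambda>n. H (1 / Suc n) i j x) \<longlonglongrightarrow> H 0 i j x"
proof -
  have "(\<lambda>n. 1 / Suc n) \<longlonglongrightarrow> (0::real)"
    using LIMSEQ_Suc[OF lim_1_over_n] .
  then have rp: "(\<lambda>n. rpow (1 / Suc n) p x) \<longlonglongrightarrow> rpow 0 p x" for p
    unfolding rpow_def using assms by (intro tendsto_powr tendsto_add tendsto_const) auto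
  have if_lim: "(\<lambda>n. if c then f n else g n) \<longlonglongrightarrow> (if c then a else b)"
    if "f \<longlonglongrightarrow> a" "g \<longlonglongrightarrow> b" for c and f g :: "nat \<Rightarrow> real" and a b
    using that by (cases c) simp_all
  show "(\<lambda>n. U (1 / Suc n) x) \<longlonglongrightarrow> U 0 x" "(\<lambda>n. G (1 / Suc n) i x) \<longlonglongrightarrow> G 0 i x"
    "(\<lambda>n. H (1 / Suc n) i j x) \<longlonglongrightarrow> H 0 i j x"
    unfolding U_def G_def H_def
    by (intro if_lim tendsto_mult tendsto_add tendsto_const rp)+
qed

subsection \<open>Integrability and weak derivatives\<close>

lemma exists_transverse: "\<exists>l. l \<noteq> k"
proof (rule ccontr)
  assume "\<nexists>l. l \<noteq> k"
  then have "(UNIV :: 'n set) = {k}" by auto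
  then have "CARD('n) = 1" by (metis card_1_singleton_iff One_nat_def)
  then show False using card_ge_4 by simp
qed

text \<open>The axis lies in a coordinate hyperplane, which is negligible.\<close>

lemma AE_rad2_pos: "AE x in lborel. rad2 x > 0"
proof -
  obtain l where l: "l \<noteq> k" using exists_transverse by blast
  have "{x. rad2 x = 0} \<subseteq> {x. x $ l = 0}"
    using component_le_rad2[OF l] by (auto simp: power2_eq_square) (metis power2_eq_square power2_less_eq_zero_iff)
  then have "negligible {x. rad2 x = 0}"
    using negligible_standard_hyperplane_cart negligible_subset by blast
  then have "AE x in lebesgue. rad2 x \<noteq> 0"
    by (simp add: negligible_iff_null_sets AE_iff_null_sets)
  then have "AE x in lborel. rad2 x \<noteq> 0"
    by (subst (asm) AE_completion_iff) auto
  then show ?thesis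
    by eventually_elim (use rad2_nonneg in \<open>auto simp: less_le\<close>)
qed

lemma emeasure_box:
  assumes "c \<le> d" "l \<le> u"
  shows "emeasure lborel (cbox (\<chi> i. if i = k then c else l) (\<chi> i. if i = k then d else u))
    = ennreal ((d - c) * (u - l) ^ (CARD('n) - 1))"
proof -
  let ?B = "cbox (\<chi> i. if i = k then c else l) (\<chi> i. if i = k then d else u) :: (real^'n) set"
  have "?B \<noteq> {}"
    using assms by (simp add: interval_ne_empty_cart)
  then have "measure lborel ?B = (\<Prod>i\<in>UNIV. if i = k then d - c else u - l)"
    by (subst content_cbox_cart, assumption) (rule prod.cong; simp)
  also have "\<dots> = (d - c) * (\<Prod>i\<in>UNIV - {k}. u - l)"
    by (subst prod.remove[of _ k]) auto
  finally show ?thesis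
    by (subst emeasure_eq_ennreal_measure)
       (use emeasure_lborel_cbox_finite[THEN less_imp_neq] in \<open>auto simp: card_Diff_singleton\<close>)
qed

text \<open>The points with \<open>4^-(m+1) < rad2 x \<le> 4^-m\<close> lie in a box
  \<open>B m\<close> of transverse half-width \<open>2^-m\<close>, and there the integrand is at
  most \<open>a m\<close>. Summing \<open>a m\<close> times the volume of \<open>B m\<close> gives a
  geometric series.\<close>

lemma integrable_rad2_powr:
  assumes "0 \<le> \<gamma>" "2 * \<gamma> < real CARD('n) - 1"
  shows "integrable lborel (\<lambda>x. indicator (cball 0 R) x * rad2 x powr - \<gamma>)"
proof (rule integrableI_bounded)
  have [measurable]: "cball (0::real^'n) R \<in> sets borel" by simp
  show "(\<lambda>x. indicator (cball 0 R) x * rad2 x powr - \<gamma>) \<in> borel_measurable lborel"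
    unfolding measurable_lborel2 by measurable
  define B :: "nat \<Rightarrow> (real^'n) set" where
    "B m = cbox (\<chi> i. if i = k then - \<bar>R\<bar> else - ((1/2) ^ m)) (\<chi> i. if i = k then \<bar>R\<bar> else (1/2) ^ m)" for m
  define a where "a m = 4 powr (\<gamma> * (real m + 1))" for m :: nat
  have [measurable]: "B m \<in> sets borel" for m by (simp add: B_def)
  have pointwise: "ennreal (norm (indicator (cball 0 R) x * rad2 x powr - \<gamma>))
      \<le> indicator (cball 0 R) x + (\<Sum>m. ennreal (a m) * indicator (B m) x)" for x
  proof (cases "norm x \<le> R \<and> 0 < rad2 x \<and> rad2 x < 1")
    case False
    \<comment> \<open>Away from the axis the power is at most 1; on the axis it is 0 by the
      convention \<open>0 powr p = 0\<close>. The first indicator covers both.\<close>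
    have "rad2 x powr - \<gamma> \<le> 1" if "rad2 x \<ge> 1"
      using powr_mono2'[of "-\<gamma>" 1 "rad2 x"] that assms by simp
    then have "indicator (cball 0 R) x * rad2 x powr - \<gamma> \<le> indicator (cball 0 R) x"
      using False rad2_nonneg[of x] by (auto simp: indicator_def)
    then have "ennreal (norm (indicator (cball 0 R) x * rad2 x powr - \<gamma>)) \<le> indicator (cball 0 R) x"
      by (auto simp: indicator_def abs_mult split: if_splits)
    then show ?thesis by (rule order_trans) simp
  next
    case True
    \<comment> \<open>The integer part of this logarithm is the index of the layer containing
      \<open>x\<close>.\<close>
    define t where "t = - log 4 (rad2 x)"
    define m where "m = nat \<lfloor>t\<rfloor>"
    have "t \<ge> 0" using True by (simp add: t_def)
    then have m: "real m \<le> t" "t < real m + 1" by (auto simp: m_def)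
    have rad: "rad2 x = 4 powr (- t)" using True by (simp add: t_def)
    have "rad2 x \<le> 4 powr (- real m)" using m by (simp add: rad)
    also have "\<dots> = ((1/2) ^ m)\<^sup>2"
    proof -
      have "(4::real) ^ m = (2 ^ m)\<^sup>2"
        by (simp add: power2_eq_square flip: power_mult_distrib)
      then show ?thesis
        by (simp add: powr_minus powr_realpow power_divide field_simps)
    qed
    finally have rad_le: "rad2 x \<le> ((1/2) ^ m)\<^sup>2" .
    have transverse: "\<bar>x $ i\<bar> \<le> (1/2) ^ m" if "i \<noteq> k" for i
    proof (rule power2_le_imp_le)
      show "\<bar>x $ i\<bar>\<^sup>2 \<le> ((1/2) ^ m)\<^sup>2"
        unfolding power2_abs using component_le_rad2[OF that, of x] rad_le by (rule order_trans)
    qed simp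
    have axial: "\<bar>x $ k\<bar> \<le> \<bar>R\<bar>"
      using True component_le_norm_cart[of x k] by linarith
    have "x \<in> B m"
      unfolding B_def mem_box_cart
    proof
      fix i
      show "(\<chi> i. if i = k then - \<bar>R\<bar> else - ((1/2) ^ m)) $ i \<le> x $ i \<and>
          x $ i \<le> (\<chi> i. if i = k then \<bar>R\<bar> else (1/2) ^ m) $ i"
      proof (cases "i = k")
        case True
        then show ?thesis using axial by (simp only: vec_lambda_beta if_True simp_thms) linarith
      next
        case False
        then show ?thesis using transverse[OF False] by (simp only: vec_lambda_beta if_False simp_thms) linarith
      qed
    qed
    have "rad2 x powr - \<gamma> = 4 powr (\<gamma> * t)" by (simp add: rad powr_powr mult.commute)
    also have "\<dots> \<le> a m"
      unfolding a_def using m assms(1) by (intro powr_mono mult_left_mono) auto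
    finally have "ennreal (norm (indicator (cball 0 R) x * rad2 x powr - \<gamma>)) \<le> ennreal (a m) * indicator (B m) x"
      using \<open>x \<in> B m\<close> True by (simp add: ennreal_leI)
    also have "\<dots> \<le> (\<Sum>m. ennreal (a m) * indicator (B m) x)"
    proof -
      have "F m \<le> suminf F" for F :: "nat \<Rightarrow> ennreal"
        using sum_le_suminf[OF summableI, of "{m}" F] by simp
      then show ?thesis .
    qed
    finally show ?thesis by (simp add: add_increasing)
  qed
  \<comment> \<open>The ratio of consecutive layers: \<open>a m\<close> grows by
    \<open>4 powr \<gamma>\<close> while the volume shrinks by \<open>2 ^ (CARD('n) - 1)\<close>.
    The hypothesis on \<gamma> says that this is below 1.\<close>
  define \<rho> where "\<rho> = 4 powr \<gamma> * (1/2) ^ (CARD('n) - 1)"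
  define c where "c = 4 powr \<gamma> * (2 * \<bar>R\<bar>) * 2 ^ (CARD('n) - 1)"
  have "\<rho> = 2 powr (2 * \<gamma> - (real CARD('n) - 1))"
  proof -
    have "(4::real) powr \<gamma> = 2 powr (2 * \<gamma>)"
      using powr_powr[of 2 2 \<gamma>] by simp
    moreover have "real CARD('n) - 1 = real (CARD('n) - 1)"
      using card_ge_4 by simp
    then have "(1/2::real) ^ (CARD('n) - 1) = 2 powr - (real CARD('n) - 1)"
      by (simp only: powr_minus powr_realpow power_one_over inverse_eq_divide zero_less_numeral)
    ultimately show ?thesis by (simp only: \<rho>_def diff_conv_add_uminus powr_add)
  qed
  also have "\<dots> < 2 powr 0" by (rule powr_less_mono) (use assms in auto)
  finally have \<rho>: "0 \<le> \<rho>" "\<rho> < 1" by (simp_all add: \<rho>_def)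
  have layer: "ennreal (a m) * emeasure lborel (B m) = ennreal (c * \<rho> ^ m)" for m
  proof -
    have "emeasure lborel (B m) = ennreal ((\<bar>R\<bar> - - \<bar>R\<bar>) * ((1/2) ^ m - - ((1/2) ^ m)) ^ (CARD('n) - 1))"
      unfolding B_def by (rule emeasure_box) auto
    also have "(\<bar>R\<bar> - - \<bar>R\<bar>) * ((1/2) ^ m - - ((1/2) ^ m)) ^ (CARD('n) - 1) =
        2 * \<bar>R\<bar> * (2 ^ (CARD('n) - 1) * ((1/2) ^ (CARD('n) - 1)) ^ m)"
      by (simp add: mult_2[symmetric] power_mult_distrib power_mult[symmetric] mult.commute)
    finally have "ennreal (a m) * emeasure lborel (B m) =
        ennreal (a m * (2 * \<bar>R\<bar> * (2 ^ (CARD('n) - 1) * ((1/2) ^ (CARD('n) - 1)) ^ m)))"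
      by (simp add: ennreal_mult' a_def)
    also have "a m * (2 * \<bar>R\<bar> * (2 ^ (CARD('n) - 1) * ((1/2) ^ (CARD('n) - 1)) ^ m)) = c * \<rho> ^ m"
    proof -
      have "a m = 4 powr \<gamma> * (4 powr \<gamma>) ^ m"
        by (simp add: a_def powr_add powr_powr[symmetric] distrib_left powr_realpow[symmetric] mult.commute)
      then show ?thesis by (simp add: c_def \<rho>_def power_mult_distrib mult_ac)
    qed
    finally show ?thesis .
  qed
  have "(\<integral>\<^sup>+ x. ennreal (norm (indicator (cball 0 R) x * rad2 x powr - \<gamma>)) \<partial>lborel)
      \<le> (\<integral>\<^sup>+ x. indicator (cball 0 R) x + (\<Sum>m. ennreal (a m) * indicator (B m) x) \<partial>lborel)"
    by (rule nn_integral_mono) (rule pointwise)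
  also have "\<dots> = emeasure lborel (cball (0::real^'n) R) + (\<Sum>m. ennreal (a m) * emeasure lborel (B m))"
    by (simp add: nn_integral_add nn_integral_suminf nn_integral_cmult_indicator)
  also have "\<dots> = emeasure lborel (cball (0::real^'n) R) + ennreal (\<Sum>m. c * \<rho> ^ m)"
    unfolding layer using \<rho> by (subst suminf_ennreal2) (auto intro!: summable_mult summable_geometric simp: c_def)
  also have "\<dots> < \<infinity>"
    using emeasure_lborel_cball_finite by (simp add: ennreal_add_less_top)
  finally show "(\<integral>\<^sup>+ x. ennreal (norm (indicator (cball 0 R) x * rad2 x powr - \<gamma>)) \<partial>lborel) < \<infinity>" .
qed

lemma \<beta>_minus_1_mult: "(\<beta> - 1) * q = - (q / real CARD('n))"
  by (simp add: \<beta>_def)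

text \<open>The \<open>q\<close>-th power of the bound is a multiple of
  \<open>rad2 x powr - (q / n)\<close>, and \<open>2 * q / n < n - 1\<close> is the assumed upper
  bound on \<open>q\<close>. The constant may depend on \<open>R\<close> because only compact sets
  are tested.\<close>

lemma Lq_locI:
  assumes [measurable]: "f \<in> borel_measurable borel"
    and bound: "\<And>R x. norm x \<le> R \<Longrightarrow> rad2 x > 0 \<Longrightarrow> \<bar>f x\<bar> \<le> C R * rad2 x powr (\<beta> - 1)"
    and q: "1 \<le> q" "q < real CARD('n) * (real CARD('n) - 1) / 2"
  shows "Lq_loc q \<Omega> f"
  unfolding Lq_loc_def
proof (intro allI impI conjI)
  fix K assume K: "compact K \<and> K \<subseteq> \<Omega>"
  then have [measurable]: "K \<in> sets borel" by (simp add: borel_compact)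
  obtain R where R: "\<And>x. x \<in> K \<Longrightarrow> norm x \<le> R"
    using K compact_imp_bounded[of K] by (auto simp: bounded_iff)
  have "(\<lambda>x. indicator K x *\<^sub>R f x) \<in> borel_measurable lborel" by measurable
  then show "set_borel_measurable lebesgue K f"
    unfolding set_borel_measurable_def by (rule measurable_completion)
  define \<gamma> where "\<gamma> = q / real CARD('n)"
  have \<gamma>: "0 \<le> \<gamma>" "2 * \<gamma> < real CARD('n) - 1"
    using q card_ge_4 by (auto simp: \<gamma>_def field_simps)
  have "integrable lborel (\<lambda>x. indicator K x *\<^sub>R \<bar>f x\<bar> powr q)"
  proof (rule Bochner_Integration.integrable_bound)
    show "integrable lborel (\<lambda>x. \<bar>C R\<bar> powr q * (indicator (cball 0 R) x * rad2 x powr - \<gamma>))"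
      by (intro integrable_mult_right integrable_rad2_powr \<gamma>)
    show "AE x in lborel. norm (indicator K x *\<^sub>R \<bar>f x\<bar> powr q)
        \<le> norm (\<bar>C R\<bar> powr q * (indicator (cball 0 R) x * rad2 x powr - \<gamma>))"
      using AE_rad2_pos
    proof eventually_elim
      fix x assume x: "rad2 x > 0"
      show "norm (indicator K x *\<^sub>R \<bar>f x\<bar> powr q)
        \<le> norm (\<bar>C R\<bar> powr q * (indicator (cball 0 R) x * rad2 x powr - \<gamma>))"
      proof (cases "x \<in> K")
        case True
        have "\<bar>f x\<bar> \<le> \<bar>C R\<bar> * rad2 x powr (\<beta> - 1)"
          using bound[OF R[OF True] x] by (rule order_trans) (simp add: mult_right_mono)
        then have "\<bar>f x\<bar> powr q \<le> (\<bar>C R\<bar> * rad2 x powr (\<beta> - 1)) powr q"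
          using q by (intro powr_mono2) auto
        also have "\<dots> = \<bar>C R\<bar> powr q * rad2 x powr - \<gamma>"
          by (simp add: powr_mult powr_powr \<beta>_minus_1_mult \<gamma>_def)
        finally show ?thesis using True R[OF True] by simp
      qed simp
    qed
  qed measurable
  then show "set_integrable lebesgue K (\<lambda>x. \<bar>f x\<bar> powr q)"
    unfolding set_integrable_def by (subst integrable_completion) auto
qed

text \<open>This makes \<open>q = 1\<close> subcritical, which supplies the local integrability that
  weak derivatives require.\<close>

lemma critical_exponent_gt_1: "1 < real CARD('n) * (real CARD('n) - 1) / 2"
proof -
  have "4 * 3 \<le> real CARD('n) * (real CARD('n) - 1)"
    using card_ge_4 by (intro mult_mono) auto
  then show ?thesis by simp
qed

lemma Lq_loc_derivs:
  assumes "1 \<le> q" "q < real CARD('n) * (real CARD('n) - 1) / 2"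
  shows "Lq_loc q \<Omega> (U 0)" "Lq_loc q \<Omega> (G 0 i)" "Lq_loc q \<Omega> (H 0 i j)"
proof -
  note * = Lq_locI[OF _ _ assms, where C = "\<lambda>R. 8 * (2 + R\<^sup>2)\<^sup>2"]
  show "Lq_loc q \<Omega> (U 0)" "Lq_loc q \<Omega> (G 0 i)" "Lq_loc q \<Omega> (H 0 i j)"
    by (rule *; (rule measurable_derivs | rule derivs_bound; simp))+
qed

text \<open>Dominated convergence: \<open>\<psi>\<close> is bounded and vanishes outside a ball, and
  the singularity of exponent \<open>\<beta> - 1 = -1/n\<close> is integrable across the
  axis.\<close>

lemma integral_times_tendsto:
  assumes [measurable]: "\<And>n. F n \<in> borel_measurable borel" "F0 \<in> borel_measurable borel"
    and bound: "\<And>n x. norm x \<le> R \<Longrightarrow> rad2 x > 0 \<Longrightarrow> \<bar>F n x\<bar> \<le> C * rad2 x powr (\<beta> - 1)"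
    and lim: "\<And>x. rad2 x > 0 \<Longrightarrow> (\<lambda>n. F n x) \<longlonglongrightarrow> F0 x"
    and \<psi>: "continuous_on UNIV \<psi>" "\<And>x. norm x > R \<Longrightarrow> \<psi> x = 0"
  shows "(\<lambda>n. LINT x|lborel. F n x * \<psi> x) \<longlonglongrightarrow> (LINT x|lborel. F0 x * \<psi> x)"
proof -
  have [measurable]: "\<psi> \<in> borel_measurable borel"
    by (rule borel_measurable_continuous_onI[OF \<psi>(1)])
  have "bounded (\<psi> ` cball 0 R)"
    using \<psi>(1) compact_cball by (meson compact_continuous_image compact_imp_bounded continuous_on_subset subset_UNIV)
  then obtain B where B: "\<And>x. norm x \<le> R \<Longrightarrow> \<bar>\<psi> x\<bar> \<le> B"
    unfolding bounded_iff by force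
  show ?thesis
  proof (rule integral_dominated_convergence)
    show "integrable lborel (\<lambda>x. (\<bar>C\<bar> * \<bar>B\<bar>) * (indicator (cball 0 R) x * rad2 x powr - (1 / real CARD('n))))"
    proof (intro integrable_mult_right integrable_rad2_powr)
      have "2 * (1 / real CARD('n)) \<le> 1"
        using card_ge_4 by (simp add: field_simps)
      then show "2 * (1 / real CARD('n)) < real CARD('n) - 1"
        using card_ge_4 by linarith
    qed simp
    show "AE x in lborel. norm (F n x * \<psi> x) \<le> (\<bar>C\<bar> * \<bar>B\<bar>) * (indicator (cball 0 R) x * rad2 x powr - (1 / real CARD('n)))" for n
      using AE_rad2_pos
    proof eventually_elim
      fix x assume x: "rad2 x > 0"
      show "norm (F n x * \<psi> x) \<le> (\<bar>C\<bar> * \<bar>B\<bar>) * (indicator (cball 0 R) x * rad2 x powr - (1 / real CARD('n)))"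
      proof (cases "norm x \<le> R")
        case True
        have "\<bar>F n x\<bar> * \<bar>\<psi> x\<bar> \<le> (\<bar>C\<bar> * rad2 x powr (\<beta> - 1)) * \<bar>B\<bar>"
        proof (rule mult_mono)
          show "\<bar>F n x\<bar> \<le> \<bar>C\<bar> * rad2 x powr (\<beta> - 1)"
            using bound[OF True x, of n] by (rule order_trans) (simp add: mult_right_mono)
          show "\<bar>\<psi> x\<bar> \<le> \<bar>B\<bar>" using B[OF True] by simp
        qed auto
        then show ?thesis using True by (simp add: abs_mult \<beta>_def mult_ac)
      qed (use \<psi> in simp)
    qed
    show "AE x in lborel. (\<lambda>n. F n x * \<psi> x) \<longlonglongrightarrow> F0 x * \<psi> x"
      using AE_rad2_pos by eventually_elim (intro tendsto_mult lim tendsto_const)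
  qed measurable
qed

text \<open>For \<epsilon> > 0 this is classical integration by parts; both sides converge along
  \<epsilon> = \<open>1 / Suc n\<close>. Only the outermost derivative of \<phi> is moved, so the
  identities can be iterated.\<close>

lemma integral_derivs:
  assumes "test_function \<Omega> \<phi>"
  shows "(LINT x|lborel. U 0 x * partials (i # is) \<phi> x) = - (LINT x|lborel. G 0 i x * partials is \<phi> x)"
    and "(LINT x|lborel. G 0 j x * partials (i # is) \<phi> x) = - (LINT x|lborel. H 0 i j x * partials is \<phi> x)"
proof -
  note \<phi> = test_functionD(1,2)[OF assms]
  obtain K where K: "compact K" "\<And>js x. x \<notin> K \<Longrightarrow> partials js \<phi> x = 0"
    using test_functionD(3)[OF assms] by blast
  obtain R where R: "\<And>x. x \<in> K \<Longrightarrow> norm x \<le> R"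
    using K compact_imp_bounded[of K] by (auto simp: bounded_iff)
  have off: "norm x > R \<Longrightarrow> partials js \<phi> x = 0" for js x
    using K(2) R by (meson not_le)
  define e where "e n = 1 / real (Suc n)" for n
  have e: "0 < e n" "0 \<le> e n" "e n \<le> 1" for n by (auto simp: e_def)
  note lim = derivs_tendsto[folded e_def]
  let ?C = "8 * (2 + R\<^sup>2)\<^sup>2"
  have U: "(\<lambda>n. LINT x|lborel. U (e n) x * partials js \<phi> x) \<longlonglongrightarrow> (LINT x|lborel. U 0 x * partials js \<phi> x)" for js
    by (rule integral_times_tendsto[where R = R and C = ?C]) (auto intro: derivs_bound e lim \<phi> off)
  have G: "(\<lambda>n. LINT x|lborel. G (e n) i x * partials js \<phi> x) \<longlonglongrightarrow> (LINT x|lborel. G 0 i x * partials js \<phi> x)" for i js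
    by (rule integral_times_tendsto[where R = R and C = ?C]) (auto intro: derivs_bound e lim \<phi> off)
  have H: "(\<lambda>n. LINT x|lborel. H (e n) i j x * partials js \<phi> x) \<longlonglongrightarrow> (LINT x|lborel. H 0 i j x * partials js \<phi> x)" for i j js
    by (rule integral_times_tendsto[where R = R and C = ?C]) (auto intro: derivs_bound e lim \<phi> off)
  have "(LINT x|lborel. U (e n) x * partials (i # is) \<phi> x) = - (LINT x|lborel. G (e n) i x * partials is \<phi> x)" for n
    by (rule integration_by_parts_partial[OF has_partial_U[OF e(1)] _ _ \<phi>(1) \<phi>(2) \<phi>(2) K(1)])
       (auto intro: continuous_on_derivs e K simp del: partials.simps)
  with U[of "i # is"] tendsto_minus[OF G[of i "is"]]
  show "(LINT x|lborel. U 0 x * partials (i # is) \<phi> x) = - (LINT x|lborel. G 0 i x * partials is \<phi> x)"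
    by (simp add: LIMSEQ_unique)
  have "(LINT x|lborel. G (e n) j x * partials (i # is) \<phi> x) = - (LINT x|lborel. H (e n) i j x * partials is \<phi> x)" for n
    by (rule integration_by_parts_partial[OF has_partial_G[OF e(1)] _ _ \<phi>(1) \<phi>(2) \<phi>(2) K(1)])
       (auto intro: continuous_on_derivs e K simp del: partials.simps)
  with G[of j "i # is"] tendsto_minus[OF H[of i j "is"]]
  show "(LINT x|lborel. G 0 j x * partials (i # is) \<phi> x) = - (LINT x|lborel. H 0 i j x * partials is \<phi> x)"
    by (simp add: LIMSEQ_unique)
qed

lemma H_sym: "H \<epsilon> i j = H \<epsilon> j i"
  by (auto simp: H_def fun_eq_iff)

lemma weak_deriv_U:
  "weak_deriv \<Omega> [] (U 0) (U 0)" "weak_deriv \<Omega> [i] (U 0) (G 0 i)" "weak_deriv \<Omega> [i, j] (U 0) (H 0 i j)"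
proof -
  note L = Lq_loc_derivs[OF order.refl critical_exponent_gt_1]
  show "weak_deriv \<Omega> [] (U 0) (U 0)"
    by (rule weak_derivI) (auto intro: L)
  show "weak_deriv \<Omega> [i] (U 0) (G 0 i)"
    by (rule weak_derivI) (auto intro: L simp: integral_derivs(1)[of _ _ i "[]", simplified])
  show "weak_deriv \<Omega> [i, j] (U 0) (H 0 i j)"
  proof (rule weak_derivI)
    fix \<phi> assume \<phi>: "test_function \<Omega> \<phi>"
    show "(LINT x|lborel. U 0 x * partials [i, j] \<phi> x) =
        (- 1) ^ length [i, j] * (LINT x|lborel. H 0 i j x * \<phi> x)"
      \<comment> \<open>Moving first \<open>i\<close> and then \<open>j\<close> produces
        \<open>H 0 j i\<close>, hence the appeal to symmetry.\<close>
      using integral_derivs(1)[OF \<phi>, of i "[j]"] integral_derivs(2)[OF \<phi>, of i j "[]"] by (simp add: H_sym)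
  qed (auto intro: L)
qed

lemma U_in_W_loc:
  assumes "1 \<le> q" "q < real CARD('n) * (real CARD('n) - 1) / 2"
  shows "U 0 \<in> W_loc 2 q \<Omega>"
  unfolding W_loc_def mem_Collect_eq
proof (intro conjI allI impI)
  show "Lq_loc q \<Omega> (U 0)" by (rule Lq_loc_derivs[OF assms])
  fix "is" :: "'n list" assume "length is \<le> 2"
  then consider "is = []" | i where "is = [i]" | i j where "is = [i, j]"
    \<comment> \<open>The rule is borrowed for its split of lists into length 0, length 1 and length
      at least 2.\<close>
    by (cases "is" rule: remdups_adj.cases) auto
  then show "\<exists>v. weak_deriv \<Omega> is (U 0) v \<and> Lq_loc q \<Omega> v"
    using weak_deriv_U[of \<Omega>] Lq_loc_derivs[OF assms, of \<Omega>] by cases blast+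
qed

subsection \<open>Hessian determinant and gradient map\<close>

text \<open>The half-width 1/4 keeps the negative term \<open>4 * \<beta> * t\<^sup>2\<close> of the
  Hessian determinant below its positive term.\<close>

definition slab :: "(real^'n) set" where "slab = {x. \<bar>x $ k\<bar> < 1/4}"

lemma slab_is_domain: "is_domain slab"
proof -
  have "open slab"
    unfolding slab_def by (intro open_Collect_less continuous_intros)
  moreover have "convex slab"
  proof (rule convexI)
    fix x y :: "real^'n" and u v :: real
    assume "x \<in> slab" "y \<in> slab" and uv: "0 \<le> u" "0 \<le> v" "u + v = 1"
    then have "u * \<bar>x $ k\<bar> + v * \<bar>y $ k\<bar> < 1/4"
      by (intro convex_bound_lt) (auto simp: slab_def)
    moreover have "\<bar>u * x $ k + v * y $ k\<bar> \<le> u * \<bar>x $ k\<bar> + v * \<bar>y $ k\<bar>"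
      using uv abs_triangle_ineq[of "u * x $ k" "v * y $ k"] by (simp add: abs_mult)
    ultimately show "u *\<^sub>R x + v *\<^sub>R y \<in> slab"
      by (simp add: slab_def)
  qed
  moreover have "0 \<in> slab" by (simp add: slab_def)
  ultimately show ?thesis
    by (auto simp: is_domain_def convex_connected)
qed

text \<open>Off the axis the Hessian has the bordered form with \<open>y\<close> the transverse part
  of \<open>x\<close>, so that the sum of squares of \<open>y\<close> is \<open>rad2 x\<close>; what
  remains is to collect the powers of \<open>rad2 x\<close>.\<close>

lemma det_hessian:
  assumes "rad2 x > 0"
  shows "det (\<chi> i j. H 0 i j x) =
    (2 * \<beta> * (1 + (x $ k)\<^sup>2)) ^ (CARD('n) - 2) *
    (4 * \<beta> * ((2 * \<beta> - 1) * (1 + (x $ k)\<^sup>2) - 4 * \<beta> * (x $ k)\<^sup>2))"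
proof -
  define s where "s = rad2 x"
  define t where "t = x $ k"
  define f where "f = 1 + t\<^sup>2"
  define r where "r = s powr (\<beta> - 1)"
  define y :: "real^'n" where "y = (\<chi> i. if i = k then 0 else x $ i)"
  define a where "a = 2 * \<beta> * r * f"
  define b where "b = 4 * \<beta> * (\<beta> - 1) * s powr (\<beta> - 2) * f"
  define c where "c = 4 * \<beta> * t * r"
  define d where "d = 2 * s powr \<beta>"
  have "s > 0" "r > 0" using assms by (simp_all add: s_def r_def)
  have "f > 0" by (simp add: f_def add_pos_nonneg)
  have "y $ k = 0" "a \<noteq> 0" "d \<noteq> 0"
    using \<beta>_bounds \<open>s > 0\<close> \<open>r > 0\<close> \<open>f > 0\<close> by (auto simp: y_def a_def d_def)
  have sr: "s powr \<beta> = s * r" and sr2: "r = s * s powr (\<beta> - 2)"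
    using \<open>s > 0\<close> by (simp_all add: r_def powr_mult_base)
  have norm_y: "(\<Sum>i\<in>UNIV. y $ i * y $ i) = s"
    unfolding s_def rad2_def y_def
    by (subst sum.remove[of _ k]) (auto simp: power2_eq_square intro!: sum.cong)
  have "(\<chi> i j. H 0 i j x) = (\<chi> i j. if i = k \<and> j = k then d else if j = k then c * y $ i
      else if i = k then c * y $ j else (if i = j then a else 0) + b * y $ i * y $ j)"
    by (auto simp: vec_eq_iff H_def rpow_def a_def b_def c_def d_def y_def r_def s_def f_def t_def)
  then have "det (\<chi> i j. H 0 i j x) = a ^ (CARD('n) - 2) * (d * (a + b * s) - c\<^sup>2 * s)"
    using det_bordered_rank_one[of y k a d c b] \<open>y $ k = 0\<close> \<open>a \<noteq> 0\<close> \<open>d \<noteq> 0\<close> card_ge_4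
    unfolding norm_y by simp
  also have "d * (a + b * s) - c\<^sup>2 * s = (s powr \<beta> * r) * (4 * \<beta> * ((2 * \<beta> - 1) * f - 4 * \<beta> * t\<^sup>2))"
  proof -
    have "b * s = 4 * \<beta> * (\<beta> - 1) * f * r"
      unfolding b_def sr2 by simp
    then have ab: "a + b * s = 2 * \<beta> * (2 * \<beta> - 1) * f * r"
      unfolding a_def by (simp add: algebra_simps)
    then show ?thesis
      unfolding ab c_def d_def sr by (simp add: algebra_simps power2_eq_square)
  qed
  also have "a ^ (CARD('n) - 2) = (2 * \<beta> * f) ^ (CARD('n) - 2) * r ^ (CARD('n) - 2)"
    by (simp add: a_def power_mult_distrib)
  also have "r ^ (CARD('n) - 2) = s powr ((\<beta> - 1) * (real CARD('n) - 2))"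
    using \<open>s > 0\<close> card_ge_4 unfolding r_def by (simp add: powr_powr flip: powr_realpow)
  also have "(2 * \<beta> * f) ^ (CARD('n) - 2) * s powr ((\<beta> - 1) * (real CARD('n) - 2)) *
      (s powr \<beta> * r * (4 * \<beta> * ((2 * \<beta> - 1) * f - 4 * \<beta> * t\<^sup>2))) =
      (2 * \<beta> * f) ^ (CARD('n) - 2) * (4 * \<beta> * ((2 * \<beta> - 1) * f - 4 * \<beta> * t\<^sup>2)) *
      (s powr ((\<beta> - 1) * (real CARD('n) - 2) + \<beta> + (\<beta> - 1)))"
    unfolding r_def powr_add by simp
  \<comment> \<open>The total exponent is \<open>n * (\<beta> - 1) + 1\<close>; its vanishing is
    what determines \<beta>.\<close>
  also have "(\<beta> - 1) * (real CARD('n) - 2) + \<beta> + (\<beta> - 1) = 0"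
    using card_ge_4 by (simp add: \<beta>_def field_simps)
  finally show ?thesis
    using \<open>s > 0\<close> by (simp add: f_def t_def)
qed

text \<open>With \<open>\<beta> \<ge> 3/4\<close> and \<open>t\<^sup>2 \<le> 1/16\<close> the
  bracket is at least \<open>1/2 - 1/4\<close>, its factor \<open>4 * \<beta>\<close> is at least 2,
  and the remaining power is at least 1.\<close>

lemma det_hessian_ge:
  assumes "rad2 x > 0" "x \<in> slab"
  shows "det (\<chi> i j. H 0 i j x) \<ge> 1/2"
proof -
  define t2 where "t2 = (x $ k)\<^sup>2"
  have "\<bar>x $ k\<bar> ^ 2 \<le> (1/4) ^ 2" using assms by (intro power_mono) (auto simp: slab_def)
  then have t2: "0 \<le> t2" "t2 \<le> 1/16" by (simp_all add: t2_def power2_eq_square)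
  have "1 * 1 \<le> (2 * \<beta>) * (1 + t2)"
    using \<beta>_bounds t2 by (intro mult_mono) auto
  then have "1 \<le> (2 * \<beta> * (1 + t2)) ^ (CARD('n) - 2)"
    by (intro one_le_power) simp
  moreover have "1/2 \<le> 4 * \<beta> * ((2 * \<beta> - 1) * (1 + t2) - 4 * \<beta> * t2)"
  proof -
    have "(1/2) * 1 \<le> (2 * \<beta> - 1) * (1 + t2)" using \<beta>_bounds t2 by (intro mult_mono) auto
    moreover have "4 * \<beta> * t2 \<le> 4 * 1 * (1/16)" using \<beta>_bounds t2 by (intro mult_mono) auto
    ultimately have "1/4 \<le> (2 * \<beta> - 1) * (1 + t2) - 4 * \<beta> * t2" by linarith
    then have "2 * (1/4) \<le> 4 * \<beta> * ((2 * \<beta> - 1) * (1 + t2) - 4 * \<beta> * t2)"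
      using \<beta>_bounds by (intro mult_mono) linarith+
    then show ?thesis by simp
  qed
  ultimately have "1 * (1/2) \<le> (2 * \<beta> * (1 + t2)) ^ (CARD('n) - 2) *
      (4 * \<beta> * ((2 * \<beta> - 1) * (1 + t2) - 4 * \<beta> * t2))"
    by (intro mult_mono) linarith+
  then show ?thesis
    by (simp add: det_hessian[OF assms(1)] t2_def)
qed

section \<open>Continuity and zeros of the gradient map\<close>

lemma continuous_on_rpow_0: "p > 0 \<Longrightarrow> continuous_on A (rpow 0 p)"
  unfolding rpow_def using rad2_nonneg by (intro continuous_on_powr' continuous_intros) auto

text \<open>Only the transverse components on the axis need an argument. There
  \<open>\<bar>x $ i\<bar> \<le> rad2 x powr (1/2)\<close> raises the exponent to
  \<open>\<beta> - 1/2 > 0\<close>, so the component is squeezed by the continuous function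
  \<open>W\<close>, which vanishes on the axis.\<close>

lemma continuous_on_G: "continuous_on A (G 0 i)"
proof (cases "i = k")
  case True
  have "continuous_on A (\<lambda>x. rpow 0 \<beta> x * (2 * x $ k))"
    using \<beta>_bounds by (intro continuous_intros continuous_on_rpow_0) auto
  then show ?thesis using True by (simp add: G_def[abs_def])
next
  case False
  define W where "W x = 2 * \<beta> * rpow 0 (\<beta> - 1/2) x * (1 + (x $ k)\<^sup>2)" for x :: "real^'n"
  have W: "continuous_on UNIV W"
    unfolding W_def using \<beta>_bounds by (intro continuous_intros continuous_on_rpow_0) auto
  have G: "G 0 i x = 2 * \<beta> * x $ i * rad2 x powr (\<beta> - 1) * (1 + (x $ k)\<^sup>2)" for x
    using False by (simp add: G_def rpow_def)
  have bound: "\<bar>G 0 i x\<bar> \<le> W x" for x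
  proof (cases "rad2 x > 0")
    case True
    have "\<bar>x $ i\<bar> \<le> rad2 x powr (1/2)"
      using component_le_rad2[OF False, of x] rad2_nonneg[of x]
      by (simp add: powr_half_sqrt real_le_rsqrt)
    then have "\<bar>x $ i\<bar> * rad2 x powr (\<beta> - 1) \<le> rad2 x powr (1/2) * rad2 x powr (\<beta> - 1)"
      by (rule mult_right_mono) simp
    also have "\<dots> = rpow 0 (\<beta> - 1/2) x"
      by (simp add: rpow_def powr_add[symmetric])
    finally have "2 * \<beta> * (\<bar>x $ i\<bar> * rad2 x powr (\<beta> - 1)) * (1 + (x $ k)\<^sup>2) \<le> W x"
      unfolding W_def using \<beta>_bounds by (intro mult_right_mono mult_left_mono) auto
    then show ?thesis
      using \<beta>_bounds by (simp add: G abs_mult mult.assoc)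
  next
    case False
    then show ?thesis using rad2_nonneg[of x] by (simp add: G W_def rpow_def)
  qed
  have "isCont (G 0 i) x" for x
  proof (cases "rad2 x > 0")
    case True
    have "isCont rad2 x"
      using continuous_on_rad2 continuous_on_eq_continuous_at by blast
    then show ?thesis
      unfolding G[abs_def] using True by (intro continuous_intros) auto
  next
    case False
    then have "rad2 x = 0" using rad2_nonneg[of x] by simp
    then have "W x = 0" "G 0 i x = 0" by (simp_all add: W_def G rpow_def)
    moreover have "(W \<longlongrightarrow> W x) (at x)"
      using W continuous_on_eq_continuous_at isCont_def by blast
    ultimately show ?thesis
      unfolding isCont_def using Lim_null_comparison[of "G 0 i" W "at x"] bound by simp
  qed
  then show ?thesis
    by (simp add: continuous_at_imp_continuous_on)
qed

definition Du :: "real^'n \<Rightarrow> real^'n" where "Du x = (\<chi> i. G 0 i x)"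

lemma continuous_on_Du: "continuous_on A Du"
  unfolding Du_def by (intro continuous_on_vec_lambda continuous_on_G)

lemma Du_on_axis:
  assumes "rad2 x = 0"
  shows "Du x = 0"
  using assms by (simp add: Du_def G_def rpow_def vec_eq_iff)

text \<open>Off the axis the transverse part of the gradient is a positive multiple of the
  transverse part of \<open>x\<close>, so it can vanish only on the axis, where the whole gradient
  is 0.\<close>

lemma Du_eq_0_if_transverse_eq_0:
  assumes "\<And>i. i \<noteq> k \<Longrightarrow> Du x $ i = 0"
  shows "Du x = 0"
proof (rule Du_on_axis, rule ccontr)
  assume "rad2 x \<noteq> 0"
  then have "rpow 0 (\<beta> - 1) x > 0" using rad2_nonneg[of x] by (simp add: rpow_def)
  moreover have "1 + (x $ k)\<^sup>2 > 0" by (simp add: add_pos_nonneg)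
  ultimately have "x $ i = 0" if "i \<noteq> k" for i
    using assms[OF that] that \<beta>_bounds by (simp add: Du_def G_def)
  then have "rad2 x = 0" by (simp add: rad2_def)
  with \<open>rad2 x \<noteq> 0\<close> show False by simp
qed

lemma rad2_axis: "rad2 (axis k t) = 0"
  by (simp add: rad2_def axis_def)

lemma norm_axis: "norm (axis k t :: real^'n) = \<bar>t\<bar>"
  by (simp add: norm_vec_def L2_set_def axis_def if_distrib[of norm] if_distrib[of "\<lambda>a. a\<^sup>2"] cong: if_cong)

lemma Du_not_open: "\<not> open_map (top_of_set slab) euclidean Du"
proof
  assume "open_map (top_of_set slab) euclidean Du"
  then have "open (Du ` slab)"
    by (simp add: open_map_def)
  moreover have "0 \<in> Du ` slab"
  proof
    show "0 = Du (axis k 0)" by (simp add: Du_on_axis rad2_axis)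
  qed (simp add: slab_def)
  ultimately obtain e where e: "e > 0" "ball 0 e \<subseteq> Du ` slab"
    using openE by blast
  have "axis k (e / 2) \<in> ball (0 :: real^'n) e"
    using e(1) by (simp add: norm_axis)
  then obtain x where x: "Du x = axis k (e / 2)" using e(2) by force
  then have "Du x = 0"
    by (intro Du_eq_0_if_transverse_eq_0) (simp add: axis_def)
  then show False
    using x e(1) by (simp add: axis_eq_0_iff)
qed

lemma Du_not_discrete: "\<not> discrete_map_on slab Du"
proof
  assume "discrete_map_on slab Du"
  then have "discrete {x \<in> slab. Du x = 0}"
    by (simp add: discrete_map_on_def)
  moreover have "0 \<in> {x \<in> slab. Du x = 0}"
    using Du_on_axis[of 0] by (simp add: slab_def rad2_def)
  ultimately have "0 isolated_in {x \<in> slab. Du x = 0}"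
    by (rule discreteD)
  then obtain e where e: "e > 0" "\<And>y. y \<in> slab \<Longrightarrow> Du y = 0 \<Longrightarrow> dist 0 y < e \<Longrightarrow> 0 = y"
    by (auto simp: isolated_in_dist_Ex_iff)
  \<comment> \<open>Small enough for a point of the axis to lie both in the isolating ball and in
    the slab.\<close>
  define t where "t = min (e / 2) (1 / 8)"
  have "0 < t" "t < e" "t < 1/4" using e(1) by (auto simp: t_def)
  then have "0 = (axis k t :: real^'n)"
    by (intro e(2)) (auto simp: slab_def Du_on_axis rad2_axis norm_axis)
  then show False using \<open>0 < t\<close> by (metis axis_eq_0_iff less_irrefl)
qed

subsection \<open>Failure of critical integrability\<close>

text \<open>Above the threshold \<open>a\<close>, the factor \<open>t powr (1 - q)\<close> is at
  most \<open>a powr (1 - q)\<close>. This takes the place of Hoelder's inequality, with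
  \<open>a\<close> free to be tuned on each cell.\<close>

lemma le_plus_powr:
  fixes a t q :: real
  assumes "a > 0" "q \<ge> 1" "t \<ge> 0"
  shows "t \<le> a + a powr (1 - q) * t powr q"
proof (cases "t \<le> a")
  case True
  then show ?thesis by (simp add: add_increasing2)
next
  case False
  then have "t > 0" using assms by simp
  then have "t = t powr (1 - q) * t powr q" by (simp add: powr_add[symmetric])
  also have "\<dots> \<le> a powr (1 - q) * t powr q"
    using False assms by (intro mult_right_mono powr_mono2') auto
  finally show ?thesis using assms(1) by simp
qed

text \<open>All transverse coordinates are of order \<open>4^-m\<close>, so \<open>rad2\<close> is
  comparable to \<open>16^-m\<close>. Since 3 < 4 the coordinate ranges for different
  \<open>m\<close> do not meet, and the axial half-length 1/8 stays away from the boundary of the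
  slab.\<close>

definition cell :: "nat \<Rightarrow> (real^'n) set" where
  "cell m = cbox (\<chi> i. if i = k then - (1/8) else (1/4) ^ m) (\<chi> i. if i = k then 1/8 else 3 * (1/4) ^ m)"

text \<open>The bump is centred in the cell, with scales the reciprocals of the half-sides, so that
  its support fits inside.\<close>

definition cell_bump :: "nat \<Rightarrow> real^'n \<Rightarrow> real" where
  "cell_bump m = bump (\<lambda>i. if i = k then 8 else 4 ^ m) (\<chi> i. if i = k then 0 else 2 * (1/4) ^ m)"

lemma mem_cell:
  "x \<in> cell m \<longleftrightarrow> \<bar>x $ k\<bar> \<le> 1/8 \<and> (\<forall>i. i \<noteq> k \<longrightarrow> (1/4) ^ m \<le> x $ i \<and> x $ i \<le> 3 * (1/4) ^ m)"
  unfolding cell_def mem_box_cart abs_le_iff by (auto split: if_splits)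

lemma emeasure_cell: "emeasure lborel (cell m) = ennreal (1/4 * (2 * (1/4) ^ m) ^ (CARD('n) - 1))"
  unfolding cell_def by (subst emeasure_box) (auto simp: field_simps)

lemma cell_subset_slab: "cell m \<subseteq> slab"
  by (auto simp: mem_cell slab_def)

lemma disjoint_cell: "disjoint_family cell"
  unfolding disjoint_family_on_def
proof (intro ballI impI)
  have *: "cell m \<inter> cell m' = {}" if "m < m'" for m m'
  proof -
    obtain l where l: "l \<noteq> k" using exists_transverse by blast
    have "(1/4::real) ^ m' \<le> (1/4) ^ Suc m" using that by (intro power_decreasing) auto
    moreover have "(0::real) < (1/4) ^ m" by simp
    ultimately have "3 * (1/4) ^ m' < (1/4::real) ^ m" by (simp only: power_Suc)
    then show ?thesis using l by (fastforce simp: mem_cell)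
  qed
  show "cell m \<inter> cell m' = {}" if "m \<noteq> m'" for m m'
    using that *[of m m'] *[of m' m] by (cases m m' rule: linorder_cases) auto
qed

lemma cell_bump_eq_0:
  assumes "x \<notin> cell m"
  shows "cell_bump m x = 0"
proof (rule ccontr)
  assume nz: "cell_bump m x \<noteq> 0"
  have le: "\<bar>(if i = k then 8 else 4 ^ m) * (x $ i - (if i = k then 0 else 2 * (1/4) ^ m))\<bar> \<le> 1" for i
    using nz bump_eq_0[of "\<lambda>i. if i = k then 8 else 4 ^ m" i x "\<chi> i. if i = k then 0 else 2 * (1/4) ^ m"]
    unfolding cell_bump_def vec_lambda_beta by (meson not_le)
  have "x \<in> cell m"
    unfolding mem_cell
  proof (intro conjI allI impI)
    show "\<bar>x $ k\<bar> \<le> 1/8" using le[of k] by simp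
    fix i assume "i \<noteq> k"
    then have "\<bar>4 ^ m * (x $ i - 2 * (1/4) ^ m)\<bar> \<le> 1" using le[of i] by simp
    moreover have "4 ^ m * (x $ i - 2 * (1/4) ^ m) = 4 ^ m * x $ i - 2"
      by (simp add: right_diff_distrib power_one_over)
    ultimately have *: "1 \<le> 4 ^ m * x $ i" "4 ^ m * x $ i \<le> 3" by auto
    then show "(1/4) ^ m \<le> x $ i" "x $ i \<le> 3 * (1/4) ^ m"
      by (simp_all add: power_one_over field_simps)
  qed
  with assms show False ..
qed

lemma test_function_cell_bump: "test_function slab (cell_bump m)"
proof -
  have "closure {x. cell_bump m x \<noteq> 0} \<subseteq> cell m"
    by (rule closure_minimal) (use cell_bump_eq_0 in \<open>auto simp: cell_def\<close>)
  moreover have "compact (cell m)" by (simp add: cell_def)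
  ultimately show ?thesis
    unfolding test_function_def using cell_subset_slab smooth_bump compact_closure
      bounded_subset[OF compact_imp_bounded]
    by (metis (no_types, lifting) cell_bump_def closure_subset subset_trans)
qed

lemma cell_bump_bounds: "0 \<le> cell_bump m x" "cell_bump m x \<le> 1"
  unfolding cell_bump_def by (rule bump_bounds)+

lemma cell_bump_measurable [measurable]: "cell_bump m \<in> borel_measurable borel"
  using test_functionD(2)[OF test_function_cell_bump, of "[]"]
  by (simp add: borel_measurable_continuous_onI)

lemma cell_measurable [measurable]: "cell m \<in> sets borel"
  by (simp add: cell_def)

text \<open>On the concentric box \<open>D\<close>, the cell shrunk by the factor
  \<open>\<tau> = 1 / (2n)\<close>, the bump is at least \<open>exp (- 2)\<close>; the bound is this
  value times the volume of \<open>D\<close>.\<close>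

lemma integral_cell_bump_ge:
  "exp (- 2) * (1 / (8 * real CARD('n)) * ((1/4) ^ m / real CARD('n)) ^ (CARD('n) - 1))
    \<le> (LINT x|lborel. cell_bump m x)"
proof -
  let ?N = "real CARD('n)"
  have N: "?N > 0" by simp
  define \<tau> where "\<tau> = 1 / (2 * ?N)"
  have "\<tau> > 0" unfolding \<tau>_def by simp
  define D :: "(real^'n) set" where
    "D = cbox (\<chi> i. if i = k then - (\<tau> / 8) else (2 - \<tau>) * (1/4) ^ m)
      (\<chi> i. if i = k then \<tau> / 8 else (2 + \<tau>) * (1/4) ^ m)"
  have D: "emeasure lborel D = ennreal ((\<tau> / 8 - - (\<tau> / 8)) * ((2 + \<tau>) * (1/4) ^ m - (2 - \<tau>) * (1/4) ^ m) ^ (CARD('n) - 1))"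
    unfolding D_def by (rule emeasure_box) (use \<open>\<tau> > 0\<close> in \<open>auto intro!: mult_right_mono\<close>)
  have "(\<tau> / 8 - - (\<tau> / 8)) * ((2 + \<tau>) * (1/4) ^ m - (2 - \<tau>) * (1/4) ^ m) ^ (CARD('n) - 1) =
      \<tau> / 4 * (2 * \<tau> * (1/4) ^ m) ^ (CARD('n) - 1)"
    by (simp add: algebra_simps)
  also have "\<dots> = 1 / (8 * ?N) * ((1/4) ^ m / ?N) ^ (CARD('n) - 1)"
    by (simp add: \<tau>_def)
  finally have mD: "measure lborel D = 1 / (8 * ?N) * ((1/4) ^ m / ?N) ^ (CARD('n) - 1)"
    using D by (simp add: measure_def)
  have ge: "exp (- 2) * indicator D x \<le> cell_bump m x" for x
  proof (cases "x \<in> D")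
    case True
    have "exp (- 2) \<le> cell_bump m x"
      unfolding cell_bump_def
    proof (rule bump_ge)
      fix i
      have mem: "(if i = k then - (\<tau> / 8) else (2 - \<tau>) * (1/4) ^ m) \<le> x $ i"
        "x $ i \<le> (if i = k then \<tau> / 8 else (2 + \<tau>) * (1/4) ^ m)"
        using True unfolding D_def mem_box_cart by (metis vec_lambda_beta)+
      have "\<bar>(if i = k then 8 else 4 ^ m) * (x $ i - (if i = k then 0 else 2 * (1/4) ^ m))\<bar> \<le> \<tau>"
      proof (cases "i = k")
        case True
        then show ?thesis using mem by (simp add: abs_le_iff)
      next
        case False
        have "\<bar>x $ i - 2 * (1/4) ^ m\<bar> \<le> \<tau> * (1/4) ^ m"
          using mem False by (simp add: abs_le_iff algebra_simps)
        then have "4 ^ m * \<bar>x $ i - 2 * (1/4) ^ m\<bar> \<le> 4 ^ m * (\<tau> * (1/4) ^ m)"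
          by (rule mult_left_mono) simp
        then show ?thesis using False by (simp add: abs_mult power_one_over)
      qed
      then show "\<bar>(if i = k then 8 else 4 ^ m) * (x $ i - (\<chi> i. if i = k then 0 else 2 * (1/4) ^ m) $ i)\<bar> \<le> 1 / (2 * ?N)"
        by (simp add: \<tau>_def)
    qed
    then show ?thesis using True by simp
  qed (simp add: cell_bump_bounds)
  have "exp (- 2) * measure lborel D = (LINT x|lborel. exp (- 2) * indicator D x)"
    by (simp add: D_def)
  also have "\<dots> \<le> (LINT x|lborel. cell_bump m x)"
  proof (rule integral_mono')
    show "integrable lborel (cell_bump m)"
      by (rule integrable_continuous_compact_support[of _ "cell m"])
         (use test_functionD(2)[OF test_function_cell_bump, of "[]"] cell_bump_eq_0 in \<open>auto simp: cell_def\<close>)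
  qed (auto simp: ge cell_bump_bounds)
  finally show ?thesis unfolding mD .
qed

text \<open>Because \<open>(x $ l)\<^sup>2 \<le> rad2 x\<close>, the negative term costs at most
  \<open>4 * \<beta> * (1 - \<beta>)\<close> times \<open>rad2 x powr (\<beta> - 1)\<close>, leaving
  \<open>2 * \<beta> * (2 * \<beta> - 1) \<ge> 3/4\<close> times that power. On the cell
  \<open>rad2 x\<close> is at most \<open>9 * n * 16^-m\<close>.\<close>

lemma hessian_diagonal_ge:
  assumes "l \<noteq> k" "x \<in> cell m"
  shows "3/4 * (9 * real CARD('n)) powr (\<beta> - 1) * (16 powr (1 / real CARD('n))) ^ m \<le> H 0 l l x"
proof -
  let ?N = "real CARD('n)"
  have x: "0 < x $ i" "(x $ i)\<^sup>2 \<le> 9 * (1/16) ^ m" if "i \<noteq> k" for i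
  proof -
    have "(0::real) < (1/4) ^ m" by simp
    then show "0 < x $ i" using assms(2) that unfolding mem_cell by (metis less_le_trans)
    then have "(x $ i)\<^sup>2 \<le> (3 * (1/4) ^ m)\<^sup>2"
      using assms(2) that unfolding mem_cell by (intro power_mono) auto
    also have "\<dots> = 9 * (1/16) ^ m"
      by (simp add: power_mult_distrib power2_eq_square flip: power_mult_distrib)
    finally show "(x $ i)\<^sup>2 \<le> 9 * (1/16) ^ m" .
  qed
  have "0 < (x $ l)\<^sup>2" using x(1)[OF assms(1)] by simp
  then have pos: "rad2 x > 0" using component_le_rad2[OF assms(1), of x] by linarith
  have "rad2 x \<le> (\<Sum>i\<in>UNIV - {k}. 9 * (1/16) ^ m)"
    unfolding rad2_def by (rule sum_mono) (use x(2) in auto)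
  also have "\<dots> \<le> (\<Sum>i\<in>(UNIV::'n set). 9 * (1/16) ^ m)"
    by (rule sum_mono2) auto
  finally have rad_le: "rad2 x \<le> 9 * ?N * (1/16) ^ m" by simp
  have "((1/16::real) ^ m) powr (\<beta> - 1) = (16 powr (1 / ?N)) ^ m"
  proof -
    have "(1/16::real) ^ m = 16 powr - real m"
      by (simp add: powr_minus powr_realpow power_one_over inverse_eq_divide)
    moreover have "(16 powr (1 / ?N)) ^ m = 16 powr (1 / ?N * real m)"
      using powr_realpow[of "16 powr (1 / ?N)" m] by (simp add: powr_powr)
    moreover have "- real m * (\<beta> - 1) = 1 / ?N * real m"
      by (simp add: \<beta>_def)
    ultimately show ?thesis by (simp only: powr_powr)
  qed
  then have "(9 * ?N) powr (\<beta> - 1) * (16 powr (1 / ?N)) ^ m = (9 * ?N * (1/16) ^ m) powr (\<beta> - 1)"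
    by (simp only: powr_mult)
  also have "\<dots> \<le> rad2 x powr (\<beta> - 1)"
    using pos rad_le \<beta>_bounds by (intro powr_mono2') auto
  finally have lower: "(9 * ?N) powr (\<beta> - 1) * (16 powr (1 / ?N)) ^ m \<le> rad2 x powr (\<beta> - 1)" (is "?L \<le> ?r") .
  have "rad2 x powr (\<beta> - 2) * (x $ l * x $ l) \<le> rad2 x powr (\<beta> - 2) * rad2 x"
    using component_le_rad2[OF assms(1), of x] by (intro mult_left_mono) (auto simp: power2_eq_square)
  also have "\<dots> = ?r" using pos by (simp add: powr_mult_base mult.commute)
  finally have mixed: "4 * \<beta> * (1 - \<beta>) * (rad2 x powr (\<beta> - 2) * (x $ l * x $ l)) \<le> 4 * \<beta> * (1 - \<beta>) * ?r"
    using \<beta>_bounds by (intro mult_left_mono) auto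
  have "3/4 * ?L \<le> (2 * \<beta> * (2 * \<beta> - 1)) * ?r"
  proof (rule mult_mono)
    have "(3/2) * (1/2) \<le> 2 * \<beta> * (2 * \<beta> - 1)" using \<beta>_bounds by (intro mult_mono) auto
    then show "3/4 \<le> 2 * \<beta> * (2 * \<beta> - 1)" by simp
  qed (use lower \<beta>_bounds in auto)
  also have "\<dots> = 2 * \<beta> * ?r - 4 * \<beta> * (1 - \<beta>) * ?r" by (simp add: algebra_simps)
  also have "\<dots> \<le> 2 * \<beta> * ?r - 4 * \<beta> * (1 - \<beta>) * (rad2 x powr (\<beta> - 2) * (x $ l * x $ l))" (is "_ \<le> ?h")
    using mixed by simp
  finally have h: "3/4 * ?L \<le> ?h" .
  have "0 \<le> 3/4 * ?L" by simp
  then have "0 \<le> ?h" using h by (rule order_trans)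
  then have "?h * 1 \<le> ?h * (1 + (x $ k)\<^sup>2)" by (intro mult_left_mono) simp
  also have "\<dots> = H 0 l l x"
    using assms(1) by (simp add: H_def rpow_def algebra_simps)
  finally show ?thesis using h by (simp add: mult.assoc)
qed


lemma U_notin_W_loc: "U 0 \<notin> W_loc 2 (real CARD('n) * (real CARD('n) - 1) / 2) slab"
proof
  let ?N = "real CARD('n)"
  define q where "q = ?N * (?N - 1) / 2"
  assume "U 0 \<in> W_loc 2 (?N * (?N - 1) / 2) slab"
  then have W: "U 0 \<in> W_loc 2 q slab" by (simp add: q_def)
  have q: "q > 1" using critical_exponent_gt_1 by (simp add: q_def)
  obtain l where l: "l \<noteq> k" using exists_transverse by blast
  have "length [l, l] \<le> 2" by simp
  with W obtain v where v: "weak_deriv slab [l, l] (U 0) v" "Lq_loc q slab v"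
    unfolding W_loc_def by blast
  define w where "w x = \<bar>v x\<bar> powr q" for x
  \<comment> \<open>A single compact subset of the slab that contains every cell, so that the
    integral of \<open>w\<close> over all cells together is finite.\<close>
  define K :: "(real^'n) set" where
    "K = cbox (\<chi> i. if i = k then - (1/8) else 0) (\<chi> i. if i = k then 1/8 else 3)"
  have mem_K: "x \<in> K \<longleftrightarrow> \<bar>x $ k\<bar> \<le> 1/8 \<and> (\<forall>i. i \<noteq> k \<longrightarrow> 0 \<le> x $ i \<and> x $ i \<le> 3)" for x
    unfolding K_def mem_box_cart abs_le_iff by (auto split: if_splits)
  have K: "compact K" "K \<subseteq> slab"
    by (auto simp: mem_K slab_def) (simp add: K_def)
  have cell_K: "cell m \<subseteq> K" for m
  proof
    fix x assume x: "x \<in> cell m"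
    have "0 \<le> x $ i \<and> x $ i \<le> 3" if "i \<noteq> k" for i
    proof -
      have "(0::real) \<le> (1/4) ^ m" "(1/4::real) ^ m \<le> 1" by (auto intro: power_le_one)
      moreover have "(1/4) ^ m \<le> x $ i" "x $ i \<le> 3 * (1/4) ^ m" using x that by (auto simp: mem_cell)
      ultimately show ?thesis by linarith
    qed
    then show "x \<in> K" using x by (simp add: mem_K mem_cell)
  qed
  have w_int: "integrable lebesgue (\<lambda>x. indicator K x * w x)"
    using v(2) K unfolding Lq_loc_def set_integrable_def w_def by simp
  have cell_leb [measurable]: "cell m \<in> sets lebesgue" for m
    by (simp add: cell_def)
  have w_cell: "integrable lebesgue (\<lambda>x. indicator (cell m) x * w x)" for m
  proof -
    have "integrable lebesgue (\<lambda>x. indicator (cell m) x *\<^sub>R (indicator K x * w x))"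
      by (rule integrable_mult_indicator) (use w_int in auto)
    moreover have "indicator (cell m) x *\<^sub>R (indicator K x * w x) = indicator (cell m) x * w x" for x
      using cell_K[of m] by (auto simp: indicator_def)
    ultimately show ?thesis by (simp only:)
  qed
  define J where "J m = (LINT x|lebesgue. indicator (cell m) x * w x)" for m

  \<comment> \<open>On cell \<open>m\<close> the second derivative is at least of size
    \<open>\<theta> ^ m\<close> and the volume is of size \<open>\<sigma> ^ m\<close>;
    \<open>c1\<close>, \<open>c2\<close>, \<open>c3\<close> are the constants for the bump integral,
    the cell volume and the second derivative.\<close>
  define \<theta> where "\<theta> = 16 powr (1 / ?N)"
  define \<sigma> :: real where "\<sigma> = (1/4) ^ (CARD('n) - 1)"
  define c1 where "c1 = exp (- 2) * (1 / (8 * ?N) * (1 / ?N) ^ (CARD('n) - 1))"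
  define c2 :: real where "c2 = 1/4 * 2 ^ (CARD('n) - 1)"
  define c3 where "c3 = 3/4 * (9 * ?N) powr (\<beta> - 1)"
  \<comment> \<open>Chosen so that at the threshold \<open>\<kappa> * \<theta> ^ m\<close> the first
    term of the upper bound is exactly half of the lower bound.\<close>
  define \<kappa> where "\<kappa> = c1 * c3 / (2 * c2)"
  define c4 where "c4 = \<kappa> powr (q - 1) * (c1 * c3 / 2)"
  have pos: "\<theta> > 0" "\<sigma> > 0" "c1 > 0" "c2 > 0" "c3 > 0"
    by (simp_all add: \<theta>_def \<sigma>_def c1_def c2_def c3_def)
  then have "\<kappa> > 0" by (simp add: \<kappa>_def)
  then have "c4 > 0" using pos by (simp add: c4_def)
  have bump_ge: "c1 * \<sigma> ^ m \<le> (LINT x|lborel. cell_bump m x)" for m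
    using integral_cell_bump_ge[of m]
    by (simp add: c1_def \<sigma>_def power_mult_distrib power_divide power_mult[symmetric] mult_ac)
  have cell_measure: "measure lebesgue (cell m) = c2 * \<sigma> ^ m" "emeasure lebesgue (cell m) < \<infinity>" for m
    using emeasure_cell[of m]
    by (simp_all add: measure_def c2_def \<sigma>_def power_mult_distrib power_mult[symmetric] mult.commute)
  \<comment> \<open>Scale invariance at the critical exponent:
    \<open>\<theta> powr q = 4 ^ (n - 1) = 1 / \<sigma>\<close>.\<close>
  have critical: "(\<theta> ^ m) powr q * \<sigma> ^ m = 1" for m
  proof -
    have "\<theta> ^ m = 16 powr (1 / ?N * real m)"
      using powr_realpow[OF pos(1), of m] by (simp add: \<theta>_def powr_powr)
    then have "(\<theta> ^ m) powr q = 16 powr ((1 / ?N * real m) * q)"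
      by (simp only: powr_powr)
    also have "(1 / ?N * real m) * q = 1/2 * (real m * (?N - 1))"
      by (simp add: q_def)
    also have "16 powr (1/2 * (real m * (?N - 1))) = (4::real) powr (real m * (?N - 1))"
      unfolding powr_powr[symmetric] by (simp add: powr_half_sqrt)
    also have "real m * (?N - 1) = real ((CARD('n) - 1) * m)"
      using card_ge_4 by simp
    also have "(4::real) powr real ((CARD('n) - 1) * m) = 4 ^ ((CARD('n) - 1) * m)"
      by (rule powr_realpow) simp
    finally show ?thesis
      by (simp add: \<sigma>_def power_one_over power_mult[symmetric])
  qed

  \<comment> \<open>Both \<open>v\<close> and \<open>H 0 l l\<close> are weak derivatives of
    \<open>U 0\<close>, so they have the same integral against the bump, and the pointwise bound on
    \<open>H 0 l l\<close> transfers to \<open>v\<close>.\<close>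
  have lower: "c3 * \<theta> ^ m * (c1 * \<sigma> ^ m) \<le> (LINT x:slab|lebesgue. v x * cell_bump m x)" for m
  proof -
    note \<phi> = test_function_cell_bump[of m]
    have H_int: "integrable lebesgue (\<lambda>x. H 0 l l x * cell_bump m x)"
    proof (rule Bochner_Integration.integrable_bound)
      show "integrable lebesgue (\<lambda>x. indicator (cell m) x *\<^sub>R \<bar>H 0 l l x\<bar> powr 1)"
        using Lq_loc_derivs(3)[OF order.refl critical_exponent_gt_1, of slab l l] cell_subset_slab[of m]
        unfolding Lq_loc_def set_integrable_def by (simp add: cell_def)
      have "(\<lambda>x. H 0 l l x * cell_bump m x) \<in> borel_measurable lborel"
        unfolding measurable_lborel2 by measurable
      then show "(\<lambda>x. H 0 l l x * cell_bump m x) \<in> borel_measurable lebesgue"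
        by (rule measurable_completion)
      show "AE x in lebesgue. norm (H 0 l l x * cell_bump m x)
          \<le> norm (indicator (cell m) x *\<^sub>R \<bar>H 0 l l x\<bar> powr 1)"
        using cell_bump_eq_0[of _ m] cell_bump_bounds[of m]
        by (intro AE_I2) (auto simp: indicator_def abs_mult mult_left_le)
    qed
    have "c3 * \<theta> ^ m * (c1 * \<sigma> ^ m) \<le> c3 * \<theta> ^ m * (LINT x|lborel. cell_bump m x)"
      using bump_ge[of m] pos by (intro mult_left_mono) auto
    also have "\<dots> = (LINT x|lebesgue. c3 * \<theta> ^ m * cell_bump m x)"
      by (simp add: integral_completion)
    also have "\<dots> \<le> (LINT x|lebesgue. H 0 l l x * cell_bump m x)"
    proof (rule integral_mono[OF _ H_int])
      have "integrable lborel (cell_bump m)"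
        by (rule integrable_continuous_compact_support[of _ "cell m"])
           (use test_functionD(2)[OF \<phi>, of "[]"] cell_bump_eq_0 in \<open>auto simp: cell_def\<close>)
      then show "integrable lebesgue (\<lambda>x. c3 * \<theta> ^ m * cell_bump m x)"
        by (simp add: integrable_completion)
      show "c3 * \<theta> ^ m * cell_bump m x \<le> H 0 l l x * cell_bump m x" for x
      proof (cases "x \<in> cell m")
        case True
        then show ?thesis
          using hessian_diagonal_ge[OF l True] cell_bump_bounds[of m x]
          by (intro mult_right_mono) (simp_all add: c3_def \<theta>_def)
      qed (simp add: cell_bump_eq_0)
    qed
    also have "\<dots> = (LINT x:slab|lebesgue. H 0 l l x * cell_bump m x)"
      unfolding set_lebesgue_integral_def
      by (rule Bochner_Integration.integral_cong)
         (use cell_bump_eq_0[of _ m] cell_subset_slab[of m] in \<open>auto simp: indicator_def\<close>)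
    also have "\<dots> = (LINT x:slab|lebesgue. v x * cell_bump m x)"
    proof -
      have "(LINT x:slab|lebesgue. U 0 x * partials [l, l] (cell_bump m) x)
          = (LINT x:slab|lebesgue. g x * cell_bump m x)" if "weak_deriv slab [l, l] (U 0) g" for g
        using that \<phi> unfolding weak_deriv_def by (simp del: partials.simps)
      from this[OF weak_deriv_U(3)] this[OF v(1)] show ?thesis by simp
    qed
    finally show ?thesis .
  qed

  have upper: "(LINT x:slab|lebesgue. v x * cell_bump m x)
      \<le> a * (c2 * \<sigma> ^ m) + a powr (1 - q) * J m" if "a > 0" for a m
  proof -
    have int0: "integrable lebesgue (indicator (cell m) :: real^'n \<Rightarrow> real)"
      using cell_measure(2)[of m] by (intro integrable_real_indicator) auto
    then have int: "integrable lebesgue (\<lambda>x. a * indicator (cell m) x)"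
      by (rule integrable_mult_right)
    have "(LINT x:slab|lebesgue. v x * cell_bump m x)
        \<le> (LINT x|lebesgue. a * indicator (cell m) x + a powr (1 - q) * (indicator (cell m) x * w x))"
      unfolding set_lebesgue_integral_def
    proof (rule integral_mono')
      show "integrable lebesgue (\<lambda>x. a * indicator (cell m) x + a powr (1 - q) * (indicator (cell m) x * w x))"
        by (intro Bochner_Integration.integrable_add int integrable_mult_right w_cell)
      fix x :: "real^'n"
      show "0 \<le> a * indicator (cell m) x + a powr (1 - q) * (indicator (cell m) x * w x)"
        using that by (simp add: w_def)
      show "indicator slab x *\<^sub>R (v x * cell_bump m x)
          \<le> a * indicator (cell m) x + a powr (1 - q) * (indicator (cell m) x * w x)"
      proof (cases "x \<in> cell m")
        case True
        have "v x * cell_bump m x \<le> \<bar>v x\<bar> * cell_bump m x"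
          using cell_bump_bounds[of m x] by (intro mult_right_mono) auto
        also have "\<dots> \<le> \<bar>v x\<bar>"
          using cell_bump_bounds[of m x] by (simp add: mult_left_le)
        also have "\<dots> \<le> a + a powr (1 - q) * w x"
          unfolding w_def using that q by (intro le_plus_powr) auto
        finally show ?thesis using True cell_subset_slab[of m] by auto
      qed (simp add: cell_bump_eq_0)
    qed
    also have "\<dots> = a * measure lebesgue (cell m) + a powr (1 - q) * J m"
      using int0 w_cell[of m] by (simp add: J_def)
    finally show ?thesis by (simp add: cell_measure)
  qed

  \<comment> \<open>Half of the lower bound is left for the \<open>q\<close>-th power term;
    multiplying by \<open>a powr (q - 1)\<close> isolates \<open>J m\<close>, and
    \<open>critical\<close> removes the dependence on \<open>m\<close>.\<close>
  have J_ge: "c4 \<le> J m" for m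
  proof -
    define a where "a = \<kappa> * \<theta> ^ m"
    have "a > 0" using \<open>\<kappa> > 0\<close> pos by (simp add: a_def)
    have "a * (c2 * \<sigma> ^ m) = c1 * c3 / 2 * (\<theta> ^ m * \<sigma> ^ m)"
      using pos by (simp add: a_def \<kappa>_def)
    moreover have "c3 * \<theta> ^ m * (c1 * \<sigma> ^ m) \<le> a * (c2 * \<sigma> ^ m) + a powr (1 - q) * J m"
      using lower[of m] upper[OF \<open>a > 0\<close>, of m] by (rule order_trans)
    moreover have "c3 * \<theta> ^ m * (c1 * \<sigma> ^ m) = 2 * (c1 * c3 / 2 * (\<theta> ^ m * \<sigma> ^ m))"
      by simp
    ultimately have "c1 * c3 / 2 * (\<theta> ^ m * \<sigma> ^ m) \<le> a powr (1 - q) * J m"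
      by linarith
    then have "a powr (q - 1) * (c1 * c3 / 2 * (\<theta> ^ m * \<sigma> ^ m)) \<le> a powr (q - 1) * (a powr (1 - q) * J m)"
      by (rule mult_left_mono) simp
    also have "\<dots> = J m"
      using \<open>a > 0\<close> by (simp add: mult.assoc[symmetric] powr_add[symmetric])
    also have "a powr (q - 1) * (c1 * c3 / 2 * (\<theta> ^ m * \<sigma> ^ m)) =
        c4 * (((\<theta> ^ m) powr (q - 1) * \<theta> ^ m) * \<sigma> ^ m)"
      using pos \<open>\<kappa> > 0\<close> by (simp add: a_def c4_def powr_mult)
    also have "(\<theta> ^ m) powr (q - 1) * \<theta> ^ m = (\<theta> ^ m) powr q"
      using pos by (simp add: powr_diff)
    finally show ?thesis by (simp add: critical)
  qed
  \<comment> \<open>The cells are disjoint and lie in \<open>K\<close>, so arbitrarily many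
    contributions of \<open>c4\<close> fit into one finite integral.\<close>
  have "real M * c4 \<le> (LINT x|lebesgue. indicator K x * w x)" for M
  proof -
    have "real M * c4 = (\<Sum>m<M. c4)" by simp
    also have "\<dots> \<le> (\<Sum>m<M. J m)" by (rule sum_mono) (rule J_ge)
    also have "\<dots> = (LINT x|lebesgue. (\<Sum>m<M. indicator (cell m) x * w x))"
      unfolding J_def by (rule Bochner_Integration.integral_sum[symmetric]) (rule w_cell)
    also have "\<dots> \<le> (LINT x|lebesgue. indicator K x * w x)"
    proof (rule integral_mono'[OF w_int])
      fix x :: "real^'n"
      show "0 \<le> indicator K x * w x" by (simp add: w_def)
      have "(\<Sum>m<M. indicator (cell m) x * w x) = indicator (\<Union>m<M. cell m) x * w x"
        by (subst indicator_UN_disjoint)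
           (use disjoint_cell in \<open>auto simp: sum_distrib_right disjoint_family_on_def\<close>)
      also have "\<dots> \<le> indicator K x * w x"
        using cell_K by (intro mult_right_mono) (auto simp: indicator_def w_def)
      finally show "(\<Sum>m<M. indicator (cell m) x * w x) \<le> indicator K x * w x" .
    qed
    finally show ?thesis .
  qed
  then show False
    using ex_less_of_nat_mult[OF \<open>c4 > 0\<close>] by (metis not_le)
qed

end

theorem theorem1p3:
  assumes "CARD('n::finite) \<ge> 4"
  shows "\<exists>(\<Omega> :: (real^'n) set) (u :: real^'n \<Rightarrow> real) (\<delta> :: real).
    is_domain \<Omega> \<and> \<delta> > 0 \<and>
    (\<forall>q::real. 1 \<le> q \<and> q < real CARD('n) * (real CARD('n) - 1) / 2 \<longrightarrow> u \<in> W_loc 2 q \<Omega>) \<and>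
    u \<notin> W_loc 2 (real CARD('n) * (real CARD('n) - 1) / 2) \<Omega> \<and>
    (\<exists>H. weak_hessian \<Omega> u H \<and> (AE x in lebesgue. x \<in> \<Omega> \<longrightarrow> det (H x) \<ge> \<delta>)) \<and>
    (\<exists>Du. weak_gradient \<Omega> u Du \<and> continuous_on \<Omega> Du \<and>
       \<not> open_map (top_of_set \<Omega>) euclidean Du \<and> \<not> discrete_map_on \<Omega> Du)"
proof -
  \<comment> \<open>Any coordinate can serve as the distinguished axis.\<close>
  interpret pogorelov "undefined :: 'n"
    using assms by unfold_locales
  have "weak_hessian slab (U 0) (\<lambda>x. \<chi> i j. H 0 i j x)"
    by (simp add: weak_hessian_def weak_deriv_U)
  moreover have "AE x in lebesgue. x \<in> slab \<longrightarrow> det (\<chi> i j. H 0 i j x) \<ge> 1/2"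
    using AE_completion[OF AE_rad2_pos] by eventually_elim (use det_hessian_ge in blast)
  moreover have "weak_gradient slab (U 0) Du"
    by (simp add: weak_gradient_def Du_def weak_deriv_U)
  ultimately show ?thesis
    using slab_is_domain U_in_W_loc U_notin_W_loc continuous_on_Du Du_not_open Du_not_discrete
    by (intro exI[of _ slab] exI[of _ "U 0"] exI[of _ "1/2"] conjI) auto
qed

end
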